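(* Let $1\leq p<\infty$ and let $(u,\psi)$ be a pair of entire functions on $\mathbb{C}$, with $\psi(z)=az+b$, $a,b\in\mathbb{C}$, $|a|\leq 1$, such that the weighted composition operator $W_{(u,\psi)}$, $W_{(u,\psi)}f=u\cdot(f\circ\psi)$, is bounded on the Fock space $\mathcal{F}_p$. (1) If $|a|=1$, then $W_{(u,\psi)}$ satisfies the Ritt's resolvent condition on $\mathcal{F}_p$ if and only if at least one of the following holds: - $a=1$, $b=0$ and $|u(0)|<1$; - $a=1$, $b=0$ and $u(0)=1$; - $a=1$, $b\neq 0$ and $|u(0)|<e^{-\frac{|b|^2}{2}}$; - $a\neq 1$ and $|u(0)|<e^{-\frac{|b|^2}{2}}$. (2) Suppose $W_{(u,\psi)}$ is compact on $\mathcal{F}_p$. If $W_{(u,\psi)}$ satisfies the Ritt's resolvent condition, then $\left|u\left(\frac{b}{1-a}\right)\right|\leq 1$. Conversely, if $\left|u\left(\frac{b}{1-a}\right)\right|<1$, then $W_{(u,\psi)}$ satisfies the Ritt's resolvent condition.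
   Context: For $1\le p<\infty$, the Fock space $\mathcal{F}_p$ is the Banach space of all entire functions $f:\mathbb{C}\to\mathbb{C}$ with $$\|f\|_p^p=\frac{p}{2\pi}\int_{\mathbb{C}}|f(z)|^p e^{-\frac{p|z|^2}{2}}\,dA(z)<\infty,$$ where $dA$ is Lebesgue area measure on $\mathbb{C}$. A bounded linear operator $T$ on a complex Banach space satisfies the Ritt's resolvent (growth) condition if every $\lambda\in\mathbb{C}$ with $|\lambda|>1$ lies in the resolvent set of $T$ and there is a constant $M>0$ such that $$\|(\lambda I-T)^{-1}\|\leq\frac{M}{|\lambda-1|}\quad\text{for all }\lambda\in\mathbb{C}\text{ with }|\lambda|>1.$$ Known background: if $u\not\equiv 0$ and $W_{(u,\psi)}$ is bounded on $\mathcal{F}_p$, then $\psi(z)=az+b$ with $|a|\le 1$; if moreover $W_{(u,\psi)}$ is compact, then $|a|<1$, so that $\frac{b}{1-a}$ is defined in part (2). *)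

theory Defs
  imports "HOL-Complex_Analysis.Complex_Analysis"
begin

text \<open>The exponent \<open>p\<close> is a term, so the Fock spaces are carrier sets of functions on the
  complex plane, and operators on them are maps of functions relativised to a carrier \<open>V\<close>
  with norm \<open>N\<close>. Their values outside \<open>V\<close> are irrelevant.\<close>

definition fock_space :: "real \<Rightarrow> (complex \<Rightarrow> complex) set" where
  "fock_space p = {f. f holomorphic_on UNIV \<and>
     integrable lborel (\<lambda>z. cmod (f z) powr p * exp (- p * (cmod z)\<^sup>2 / 2))}"

definition fock_norm :: "real \<Rightarrow> (complex \<Rightarrow> complex) \<Rightarrow> real" where
  "fock_norm p f =
     (p / (2 * pi) * (\<integral>z. cmod (f z) powr p * exp (- p * (cmod z)\<^sup>2 / 2) \<partial>lborel)) powr (1 / p)"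

definition weighted_comp ::
  "(complex \<Rightarrow> complex) \<Rightarrow> (complex \<Rightarrow> complex) \<Rightarrow> (complex \<Rightarrow> complex) \<Rightarrow> complex \<Rightarrow> complex" where
  "weighted_comp u \<psi> f = (\<lambda>z. u z * f (\<psi> z))"

definition bounded_op_on ::
  "('a \<Rightarrow> complex) set \<Rightarrow> (('a \<Rightarrow> complex) \<Rightarrow> real) \<Rightarrow>
   (('a \<Rightarrow> complex) \<Rightarrow> 'a \<Rightarrow> complex) \<Rightarrow> bool" where
  "bounded_op_on V N T \<longleftrightarrow>
     (\<forall>f\<in>V. T f \<in> V) \<and>
     (\<forall>f\<in>V. \<forall>g\<in>V. T (\<lambda>x. f x + g x) = (\<lambda>x. T f x + T g x)) \<and>
     (\<forall>c. \<forall>f\<in>V. T (\<lambda>x. c * f x) = (\<lambda>x. c * T f x)) \<and>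
     (\<exists>C. \<forall>f\<in>V. N (T f) \<le> C * N f)"

text \<open>As in \<^const>\<open>onorm\<close>, the vector \<open>f = 0\<close> contributes \<open>0 / 0 = 0\<close>.\<close>

definition onorm_on ::
  "('a \<Rightarrow> complex) set \<Rightarrow> (('a \<Rightarrow> complex) \<Rightarrow> real) \<Rightarrow>
   (('a \<Rightarrow> complex) \<Rightarrow> 'a \<Rightarrow> complex) \<Rightarrow> real" where
  "onorm_on V N T = (SUP f\<in>V. N (T f) / N f)"

definition compact_op_on ::
  "('a \<Rightarrow> complex) set \<Rightarrow> (('a \<Rightarrow> complex) \<Rightarrow> real) \<Rightarrow>
   (('a \<Rightarrow> complex) \<Rightarrow> 'a \<Rightarrow> complex) \<Rightarrow> bool" where
  "compact_op_on V N T \<longleftrightarrow> bounded_op_on V N T \<and>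
     (let X = Metric_space.mtopology V (\<lambda>f g. N (\<lambda>x. f x - g x))
      in compactin X (X closure_of (T ` {f\<in>V. N f \<le> 1})))"

definition resolvent_on ::
  "('a \<Rightarrow> complex) set \<Rightarrow> (('a \<Rightarrow> complex) \<Rightarrow> 'a \<Rightarrow> complex) \<Rightarrow> complex \<Rightarrow>
   ('a \<Rightarrow> complex) \<Rightarrow> 'a \<Rightarrow> complex" where
  "resolvent_on V T \<mu> = inv_into V (\<lambda>f x. \<mu> * f x - T f x)"

definition in_resolvent_set_on ::
  "('a \<Rightarrow> complex) set \<Rightarrow> (('a \<Rightarrow> complex) \<Rightarrow> real) \<Rightarrow>
   (('a \<Rightarrow> complex) \<Rightarrow> 'a \<Rightarrow> complex) \<Rightarrow> complex \<Rightarrow> bool" where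
  "in_resolvent_set_on V N T \<mu> \<longleftrightarrow>
     bij_betw (\<lambda>f x. \<mu> * f x - T f x) V V \<and> bounded_op_on V N (resolvent_on V T \<mu>)"

definition ritt_condition_on ::
  "('a \<Rightarrow> complex) set \<Rightarrow> (('a \<Rightarrow> complex) \<Rightarrow> real) \<Rightarrow>
   (('a \<Rightarrow> complex) \<Rightarrow> 'a \<Rightarrow> complex) \<Rightarrow> bool" where
  "ritt_condition_on V N T \<longleftrightarrow> bounded_op_on V N T \<and>
     (\<forall>\<mu>. cmod \<mu> > 1 \<longrightarrow> in_resolvent_set_on V N T \<mu>) \<and>
     (\<exists>M>0. \<forall>\<mu>. cmod \<mu> > 1 \<longrightarrow> onorm_on V N (resolvent_on V T \<mu>) \<le> M / cmod (\<mu> - 1))"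

end

theory Submission
  imports Defs "HOL-Probability.Distributions"
begin

text \<open>If \<open>\<mu> - W\<close> is bounded below by \<open>d * \<bar>\<mu>\<bar>\<close> for all \<open>\<bar>\<mu>\<bar> \<ge> 1\<close>,
  then Ritt's condition holds, by continuation from large \<open>\<mu>\<close>; conversely, Ritt's condition gives
  \<open>\<bar>\<mu> - 1\<bar> * N f \<le> M * N (\<mu> f - W f)\<close> for all \<open>\<bar>\<mu>\<bar> \<ge> 1\<close>, so that \<open>1\<close> is the only possible
  approximate eigenvalue outside the open unit disc.

  For \<open>\<bar>a\<bar> = 1\<close>, testing \<open>W\<close> on the normalised reproducing kernels and Liouville's theorem show that
  \<open>W\<close> is a Weyl isometry times a constant of modulus \<open>\<bar>u 0\<bar> exp (\<bar>b\<bar>\<^sup>2 / 2)\<close>. If this is less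
  than \<open>1\<close>, the lower bound is immediate; otherwise a rotation (\<open>a \<noteq> 1\<close>) has two different unimodular
  multiples as eigenvalues, and a translation (\<open>a = 1\<close>, \<open>b \<noteq> 0\<close>) has a whole circle of approximate
  eigenvalues. For \<open>\<bar>a\<bar> < 1\<close> and compact \<open>W\<close>, the lower bound follows from the absence of eigenvalues
  \<open>\<bar>\<mu>\<bar> \<ge> 1\<close>, which is seen by iterating towards the fixed point \<open>b / (1 - a)\<close>.\<close>

subsection \<open>Translations and rotations of the plane\<close>

text \<open>All exponents p are treated alike, without duality or adjoints. What is used of the norm
  is its invariance under Weyl operators, the bound |f(0)| \<le> C ||f||, which these operators
  carry to every other point, and completeness. A lower bound for \<open>\<mu> - T\<close> yields
  injectivity but not surjectivity. Continuation in \<open>\<mu>\<close> supplies the latter, also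
  for compact operators, where it takes the place of the Fredholm alternative. The factor |\<mu>| in
  the bound provides the decay of the resolvent at infinity and lets geometrically growing steps
  suffice. A unimodular translation has no eigenfunctions, since the weighted modulus of one would
  be periodic along b. Sums of kernels with centres along a line replace them. Part (2) is stated
  for |a| \<le> 1, so compact operators with |a| = 1 have to be covered as well; for a = 1 the point
  \<open>b / (1 - a)\<close> reads 0.\<close>

lemma nn_integral_lborel_translate:
  fixes t :: "'a::euclidean_space"
  assumes [measurable]: "g \<in> borel_measurable borel"
  shows "(\<integral>\<^sup>+x. g (t + x) \<partial>lborel) = (\<integral>\<^sup>+x. g x \<partial>lborel)"
proof -
  have "(\<integral>\<^sup>+x. g x \<partial>lborel) = (\<integral>\<^sup>+x. g x \<partial>distr lborel borel ((+) t))"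
    by (simp add: lborel_distr_plus)
  also have "\<dots> = (\<integral>\<^sup>+x. g (t + x) \<partial>lborel)"
    by (subst nn_integral_distr) auto
  finally show ?thesis ..
qed

lemma measurable_Complex [measurable]:
  "(\<lambda>q. Complex (fst q) (snd q)) \<in> borel_measurable borel"
  unfolding Complex_eq by (intro borel_measurable_continuous_onI continuous_intros)

text \<open>Preimages of boxes are boxes with the same side lengths, and boxes determine
  \<open>lborel\<close>. This opens the plane to Fubini.\<close>

lemma distr_lborel_Complex:
  "distr lborel borel (\<lambda>q. Complex (fst q) (snd q)) = lborel"
proof (rule lborel_eqI[symmetric])
  fix l u :: complex
  assume le: "\<And>b. b \<in> Basis \<Longrightarrow> l \<bullet> b \<le> u \<bullet> b"
  have le': "Re l \<le> Re u" "Im l \<le> Im u"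
    using le[of 1] le[of \<i>] by (auto simp: Basis_complex_def)
  have *: "(\<lambda>q. Complex (fst q) (snd q)) -` box l u = box (Re l, Im l) (Re u, Im u)"
    by (auto simp: box_def Basis_complex_def Basis_prod_def)
  have "emeasure (distr lborel borel (\<lambda>q. Complex (fst q) (snd q))) (box l u)
      = emeasure lborel (box (Re l, Im l) (Re u, Im u))"
    by (subst emeasure_distr) (auto simp: *)
  also have "\<dots> = (\<Prod>b\<in>Basis. (u - l) \<bullet> b)"
    using le' by (subst emeasure_lborel_box) (auto simp: Basis_complex_def Basis_prod_def prod.union_disjoint)
  finally show "emeasure (distr lborel borel (\<lambda>q. Complex (fst q) (snd q))) (box l u) = (\<Prod>b\<in>Basis. (u - l) \<bullet> b)" .
qed simp

lemma nn_integral_complex_iterated: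
  assumes g [measurable]: "g \<in> borel_measurable borel"
  shows "(\<integral>\<^sup>+z. g z \<partial>lborel) = (\<integral>\<^sup>+x. \<integral>\<^sup>+y. g (Complex x y) \<partial>lborel \<partial>lborel)" (is ?A)
    and "(\<integral>\<^sup>+z. g z \<partial>lborel) = (\<integral>\<^sup>+y. \<integral>\<^sup>+x. g (Complex x y) \<partial>lborel \<partial>lborel)" (is ?B)
proof -
  have m: "(\<lambda>q. g (Complex (fst q) (snd q))) \<in> borel_measurable (lborel \<Otimes>\<^sub>M lborel)"
    by (simp add: lborel_prod)
  have "(\<integral>\<^sup>+z. g z \<partial>lborel) = (\<integral>\<^sup>+q. g (Complex (fst q) (snd q)) \<partial>lborel)"
    by (subst distr_lborel_Complex[symmetric], subst nn_integral_distr) auto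
  also have "\<dots> = (\<integral>\<^sup>+q. g (Complex (fst q) (snd q)) \<partial>(lborel \<Otimes>\<^sub>M lborel))"
    by (simp add: lborel_prod)
  finally have eq: "(\<integral>\<^sup>+z. g z \<partial>lborel) = \<dots>" .
  show ?A
    using lborel.nn_integral_fst[OF m] eq by simp
  show ?B
    using lborel_pair.nn_integral_snd[of "\<lambda>q. g (Complex (fst q) (snd q))"] m eq by simp
qed

text \<open>On each line parallel to the direction of the shear the map is a translation, so Fubini
  reduces the claim to dimension one.\<close>

lemma nn_integral_complex_shear:
  assumes g [measurable]: "g \<in> borel_measurable borel"
  shows "(\<integral>\<^sup>+z. g (z + of_real (t * Im z)) \<partial>lborel) = (\<integral>\<^sup>+z. g z \<partial>lborel)" (is ?A)
    and "(\<integral>\<^sup>+z. g (z + \<i> * of_real (t * Re z)) \<partial>lborel) = (\<integral>\<^sup>+z. g z \<partial>lborel)" (is ?B)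
proof -
  have C: "Complex x y + of_real (t * Im (Complex x y)) = Complex (t * y + x) y"
          "Complex x y + \<i> * of_real (t * Re (Complex x y)) = Complex x (t * x + y)" for x y
    by (auto simp: complex_eq_iff)
  have [measurable]: "(\<lambda>x. g (Complex x y)) \<in> borel_measurable borel"
                     "(\<lambda>y. g (Complex x y)) \<in> borel_measurable borel" for x y
    unfolding Complex_eq by measurable
  have "(\<integral>\<^sup>+z. g (z + of_real (t * Im z)) \<partial>lborel)
      = (\<integral>\<^sup>+y. \<integral>\<^sup>+x. g (Complex (t * y + x) y) \<partial>lborel \<partial>lborel)"
    by (subst nn_integral_complex_iterated(2)) (simp_all only: C, measurable)
  also have "\<dots> = (\<integral>\<^sup>+y. \<integral>\<^sup>+x. g (Complex x y) \<partial>lborel \<partial>lborel)"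
    by (intro nn_integral_cong nn_integral_lborel_translate) measurable
  finally show ?A by (simp add: nn_integral_complex_iterated(2)[OF g])
  have "(\<integral>\<^sup>+z. g (z + \<i> * of_real (t * Re z)) \<partial>lborel)
      = (\<integral>\<^sup>+x. \<integral>\<^sup>+y. g (Complex x (t * x + y)) \<partial>lborel \<partial>lborel)"
    by (subst nn_integral_complex_iterated(1)) (simp_all only: C, measurable)
  also have "\<dots> = (\<integral>\<^sup>+x. \<integral>\<^sup>+y. g (Complex x y) \<partial>lborel \<partial>lborel)"
    by (intro nn_integral_cong nn_integral_lborel_translate) measurable
  finally show ?B by (simp add: nn_integral_complex_iterated(1)[OF g])
qed

text \<open>A rotation by an angle other than \<open>\<pi>\<close> is a product of three shears, and the rotation by
  \<open>\<pi>\<close> is a square.\<close>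

lemma nn_integral_complex_rotate:
  assumes g [measurable]: "g \<in> borel_measurable borel" and a: "cmod a = 1"
  shows "(\<integral>\<^sup>+z. g (a * z) \<partial>lborel) = (\<integral>\<^sup>+z. g z \<partial>lborel)"
proof -
  have *: "(\<integral>\<^sup>+z. g (c * z) \<partial>lborel) = (\<integral>\<^sup>+z. g z \<partial>lborel)"
    if c: "cmod c = 1" "c \<noteq> -1" and g [measurable]: "g \<in> borel_measurable borel" for c g
  proof -
    have cc: "(Re c)\<^sup>2 + (Im c)\<^sup>2 = 1"
      using c by (metis cmod_power2 one_power2)
    have "Re c \<noteq> -1"
    proof
      assume "Re c = -1"
      with cc have "Im c = 0" by simp
      with \<open>Re c = -1\<close> c(2) show False by (simp add: complex_eq_iff)
    qed
    hence nz: "1 + Re c \<noteq> 0" by linarith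
    \<comment> \<open>For c = exp(i \<theta>) this is - tan(\<theta>/2), and the middle shear has
      slope sin \<theta>. The point c = -1 is where the tangent is infinite.\<close>
    define t where "t = - Im c / (1 + Re c)"
    define X where "X = (\<lambda>z::complex. z + of_real (t * Im z))"
    define Y where "Y = (\<lambda>z::complex. z + \<i> * of_real (Im c * Re z))"
    have t1: "t * (1 + Re c) = - Im c" using nz by (simp add: t_def)
    have t2: "1 + Im c * t = Re c"
    proof -
      have "(1 + Im c * t) * (1 + Re c) = (1 + Re c) - (Im c)\<^sup>2"
        using arg_cong[OF t1, of "\<lambda>s. s * Im c"] by (simp add: algebra_simps power2_eq_square)
      also have "\<dots> = Re c * (1 + Re c)"
        using cc by (simp add: algebra_simps power2_eq_square)
      finally show ?thesis using nz by simp
    qed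
    have XYX: "X (Y (X z)) = c * z" for z
    proof -
      have im: "Im z + Im c * (Re z + t * Im z) = Re c * Im z + Im c * Re z"
        using arg_cong[OF t2, of "\<lambda>s. s * Im z"] by (simp add: algebra_simps)
      have "t * Im z + t * (Re c * Im z) = - (Im c * Im z)"
        using arg_cong[OF t1, of "\<lambda>s. s * Im z"] by (simp add: algebra_simps)
      moreover have "Re z + t * (Im c * Re z) = Re c * Re z"
        using arg_cong[OF t2, of "\<lambda>s. s * Re z"] by (simp add: algebra_simps)
      ultimately have re: "Re z + t * Im z + t * (Re c * Im z + Im c * Re z) = Re c * Re z - Im c * Im z"
        by (simp add: algebra_simps)
      show ?thesis
        using im re by (simp add: complex_eq_iff X_def Y_def)
    qed
    have [measurable]: "X \<in> borel_measurable borel" "Y \<in> borel_measurable borel"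
      unfolding X_def Y_def by measurable
    have "(\<integral>\<^sup>+z. g (c * z) \<partial>lborel) = (\<integral>\<^sup>+z. (\<lambda>w. g (X (Y w))) (X z) \<partial>lborel)"
      by (simp add: XYX)
    also have "\<dots> = (\<integral>\<^sup>+z. (\<lambda>w. g (X w)) (Y z) \<partial>lborel)"
      unfolding X_def[of] by (rule nn_integral_complex_shear(1)) (simp_all add: X_def[symmetric])
    also have "\<dots> = (\<integral>\<^sup>+z. g (X z) \<partial>lborel)"
      unfolding Y_def by (rule nn_integral_complex_shear(2)) measurable
    also have "\<dots> = (\<integral>\<^sup>+z. g z \<partial>lborel)"
      unfolding X_def by (rule nn_integral_complex_shear(1)) measurable
    finally show ?thesis .
  qed
  show ?thesis
  proof (cases "a = -1")
    case True
    have "(\<integral>\<^sup>+z. g (\<i> * (\<i> * z)) \<partial>lborel) = (\<integral>\<^sup>+z. g (\<i> * z) \<partial>lborel)"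
      by (rule *[of \<i> "\<lambda>w. g (\<i> * w)"]) (auto simp: complex_eq_iff)
    also have "\<dots> = (\<integral>\<^sup>+z. g z \<partial>lborel)"
      by (rule *) (auto simp: complex_eq_iff)
    finally show ?thesis using True by (simp add: mult.assoc[symmetric])
  qed (use * a g in blast)
qed

lemma nn_integral_gaussian_complex:
  assumes "s > 0"
  shows "(\<integral>\<^sup>+z. ennreal (exp (- s * (cmod z)\<^sup>2)) \<partial>lborel) < \<infinity>"
proof -
  \<comment> \<open>The deviation for which the normal density is a multiple of
    \<open>exp (- s * x\<^sup>2)\<close>.\<close>
  define \<sigma> where "\<sigma> = 1 / sqrt (2 * s)"
  have \<sigma>: "0 < \<sigma>" "2 * \<sigma>\<^sup>2 = 1 / s"
    using assms by (auto simp: \<sigma>_def power_divide)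
  have "integrable lborel (\<lambda>x. sqrt (2 * pi * \<sigma>\<^sup>2) * normal_density 0 \<sigma> x)"
    using integrable_normal_moment[OF \<sigma>(1), of 0 0] by simp
  also have "(\<lambda>x. sqrt (2 * pi * \<sigma>\<^sup>2) * normal_density 0 \<sigma> x) = (\<lambda>x. exp (- s * x\<^sup>2))"
    using \<sigma> assms by (auto simp: normal_density_def fun_eq_iff)
  finally have "integrable lborel (\<lambda>x::real. exp (- s * x\<^sup>2))" .
  hence fin: "(\<integral>\<^sup>+x. ennreal (exp (- s * x\<^sup>2)) \<partial>lborel) < \<infinity>"
    by (simp add: integrable_iff_bounded)
  have "(\<integral>\<^sup>+z. ennreal (exp (- s * (cmod z)\<^sup>2)) \<partial>lborel)
      = (\<integral>\<^sup>+(z::complex). (\<Prod>b\<in>Basis. ennreal (exp (- s * (z \<bullet> b)\<^sup>2))) \<partial>lborel)"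
    by (intro nn_integral_cong)
       (simp add: Basis_complex_def cmod_power2 ennreal_mult[symmetric] exp_add[symmetric] algebra_simps)
  also have "\<dots> = (\<Prod>b\<in>(Basis::complex set). (\<integral>\<^sup>+x. ennreal (exp (- s * x\<^sup>2)) \<partial>lborel))"
    by (rule nn_integral_lborel_prod) auto
  also have "\<dots> < \<infinity>"
    using fin by (simp add: ennreal_mult_less_top power_less_top_ennreal)
  finally show ?thesis .
qed

subsection \<open>Fock norms and Weyl operators\<close>

text \<open>With the weight attached to the modulus, the Fock norm is for every p a multiple of the
  plain L^p norm of this function.\<close>

definition fock_mod :: "(complex \<Rightarrow> complex) \<Rightarrow> complex \<Rightarrow> real" where
  "fock_mod f z = cmod (f z) * exp (- (cmod z)\<^sup>2 / 2)"

text \<open>Valued in \<open>ennreal\<close>, so that membership is finiteness, and Tonelli and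
  Fatou apply without integrability conditions.\<close>

definition fock_int :: "real \<Rightarrow> (complex \<Rightarrow> complex) \<Rightarrow> ennreal" where
  "fock_int p f = (\<integral>\<^sup>+z. ennreal (fock_mod f z powr p) \<partial>lborel)"

lemma fock_mod_nonneg [simp]: "0 \<le> fock_mod f z"
  by (simp add: fock_mod_def)

lemma fock_mod_powr: "cmod (f z) powr p * exp (- p * (cmod z)\<^sup>2 / 2) = fock_mod f z powr p"
  by (simp add: fock_mod_def powr_mult exp_powr_real)

lemma holomorphic_borel_measurable:
  "f holomorphic_on UNIV \<Longrightarrow> f \<in> borel_measurable borel"
  by (intro borel_measurable_continuous_onI holomorphic_on_imp_continuous_on)

lemma fock_mod_measurable [measurable]:
  "f \<in> borel_measurable borel \<Longrightarrow> fock_mod f \<in> borel_measurable borel"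
proof -
  assume [measurable]: "f \<in> borel_measurable borel"
  have [measurable]: "(\<lambda>z::complex. exp (- (cmod z)\<^sup>2 / 2)) \<in> borel_measurable borel"
    by (intro borel_measurable_continuous_onI continuous_intros) auto
  show "fock_mod f \<in> borel_measurable borel"
    unfolding fock_mod_def[abs_def] by measurable
qed

lemma fock_space_iff: "f \<in> fock_space p \<longleftrightarrow> f holomorphic_on UNIV \<and> fock_int p f < \<infinity>"
proof -
  have "(\<lambda>z. fock_mod f z powr p) \<in> borel_measurable borel" if "f holomorphic_on UNIV"
    using holomorphic_borel_measurable[OF that] by measurable
  thus ?thesis
    unfolding fock_space_def fock_int_def mem_Collect_eq fock_mod_powr
    by (auto simp: integrable_iff_bounded)
qed

lemma fock_norm_nonneg [simp]: "0 \<le> fock_norm p f"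
  by (simp add: fock_norm_def)

lemma fock_int_eq_norm:
  assumes "p \<ge> 1" "f \<in> fock_space p"
  shows "fock_int p f = ennreal (2 * pi / p * fock_norm p f powr p)"
proof -
  have int: "integrable lborel (\<lambda>z. fock_mod f z powr p)"
    using assms unfolding fock_space_def fock_mod_powr by simp
  let ?I = "\<integral>z. fock_mod f z powr p \<partial>lborel"
  have I: "fock_int p f = ennreal ?I"
    unfolding fock_int_def by (intro nn_integral_eq_integral int) simp
  have "0 \<le> ?I" by simp
  hence "fock_norm p f powr p = p / (2 * pi) * ?I"
    using assms(1) unfolding fock_norm_def fock_mod_powr by (simp add: powr_powr)
  with assms(1) I show ?thesis by simp
qed

lemma fock_norm_leI:
  assumes "p \<ge> 1" "f \<in> fock_space p" "fock_int p f \<le> ennreal (2 * pi / p * R powr p)" "0 \<le> R"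
  shows "fock_norm p f \<le> R"
proof -
  have "2 * pi / p * fock_norm p f powr p \<le> 2 * pi / p * R powr p"
    using assms by (simp add: fock_int_eq_norm)
  hence "fock_norm p f powr p \<le> R powr p"
    using assms(1) by (subst (asm) mult_le_cancel_left_pos) auto
  thus ?thesis
    using assms(1,4) powr_less_mono2[of p R "fock_norm p f"] by (auto simp: not_less[symmetric])
qed

lemma cmod_affine_power2:
  assumes "cmod a = 1"
  shows "(cmod (a * z + b))\<^sup>2 = (cmod z)\<^sup>2 + 2 * Re (a * cnj b * z) + (cmod b)\<^sup>2"
proof -
  have "(cmod (w + b))\<^sup>2 = (cmod w)\<^sup>2 + (cmod b)\<^sup>2 + 2 * Re (w * cnj b)" for w
    unfolding cmod_power2 by (simp add: power2_eq_square algebra_simps)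
  from this[of "a * z"] show ?thesis using assms by (simp add: norm_mult algebra_simps)
qed

text \<open>A rotation followed by a translation preserves area. Weyl operators (c = 1) and scalar
  multiples (a = 1, b = 0) are the two instances.\<close>

lemma fock_isometry:
  assumes p: "p \<ge> 1" and f: "f \<in> fock_space p" and g: "g holomorphic_on UNIV"
    and a: "cmod a = 1" and c: "c \<ge> 0"
    and eq: "\<And>z. fock_mod g z = c * fock_mod f (a * z + b)"
  shows "g \<in> fock_space p" and "fock_norm p g = c * fock_norm p f"
proof -
  have [measurable]: "f \<in> borel_measurable borel"
    using f by (auto simp: fock_space_iff holomorphic_borel_measurable)
  have "fock_int p g = (\<integral>\<^sup>+z. ennreal (c powr p) * ennreal (fock_mod f (b + a * z) powr p) \<partial>lborel)"
    unfolding fock_int_def eq using c by (simp add: powr_mult ennreal_mult add.commute)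
  also have "\<dots> = ennreal (c powr p) * (\<integral>\<^sup>+z. ennreal (fock_mod f (b + a * z) powr p) \<partial>lborel)"
    by (rule nn_integral_cmult) measurable
  also have "(\<integral>\<^sup>+z. ennreal (fock_mod f (b + a * z) powr p) \<partial>lborel)
       = (\<integral>\<^sup>+z. ennreal (fock_mod f (b + z) powr p) \<partial>lborel)"
    by (rule nn_integral_complex_rotate[OF _ a, of "\<lambda>z. ennreal (fock_mod f (b + z) powr p)"]) measurable
  also have "\<dots> = fock_int p f"
    unfolding fock_int_def
    by (rule nn_integral_lborel_translate[of "\<lambda>z. ennreal (fock_mod f z powr p)"]) measurable
  finally have I: "fock_int p g = ennreal (c powr p) * fock_int p f" .
  thus 1: "g \<in> fock_space p"
    using f g by (auto simp: fock_space_iff ennreal_mult_less_top)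
  have "ennreal (2 * pi / p * fock_norm p g powr p) = ennreal (2 * pi / p * (c * fock_norm p f) powr p)"
    using I c p unfolding fock_int_eq_norm[OF p 1] fock_int_eq_norm[OF p f]
    by (simp add: powr_mult ennreal_mult[symmetric] algebra_simps)
  hence "fock_norm p g powr p = (c * fock_norm p f) powr p"
    using p by (subst (asm) ennreal_inj) auto
  hence "(fock_norm p g powr p) powr (1 / p) = ((c * fock_norm p f) powr p) powr (1 / p)"
    by simp
  thus "fock_norm p g = c * fock_norm p f"
    using p c by (simp only: powr_powr) simp
qed

text \<open>The factor compensates the change of the Gaussian weight under z -> a z + b. In
  particular \<open>weyl 1 (- w)\<close> sends the constant 1 to the normalised reproducing kernel
  at w.\<close>

definition weyl :: "complex \<Rightarrow> complex \<Rightarrow> (complex \<Rightarrow> complex) \<Rightarrow> complex \<Rightarrow> complex" where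
  "weyl a b f z = exp (- a * cnj b * z - of_real ((cmod b)\<^sup>2 / 2)) * f (a * z + b)"

lemma fock_mod_weyl: "cmod a = 1 \<Longrightarrow> fock_mod (weyl a b f) z = fock_mod f (a * z + b)"
proof -
  assume "cmod a = 1"
  hence "exp (- Re (a * cnj b * z) - (cmod b)\<^sup>2 / 2) * exp (- (cmod z)\<^sup>2 / 2) = exp (- (cmod (a * z + b))\<^sup>2 / 2)"
    unfolding exp_add[symmetric] by (subst cmod_affine_power2) (auto simp: field_simps)
  thus ?thesis
    by (simp add: fock_mod_def weyl_def norm_mult)
qed

lemma holomorphic_weyl:
  assumes "f holomorphic_on UNIV"
  shows "weyl a b f holomorphic_on UNIV"
proof -
  have "(f \<circ> (\<lambda>z. a * z + b)) holomorphic_on UNIV"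
    by (rule holomorphic_on_compose_gen[OF _ assms]) (auto intro!: holomorphic_intros)
  thus ?thesis
    unfolding weyl_def[abs_def] by (auto simp: o_def intro!: holomorphic_intros)
qed

lemma weyl_isometry:
  assumes "p \<ge> 1" "f \<in> fock_space p" "cmod a = 1"
  shows "weyl a b f \<in> fock_space p" "fock_norm p (weyl a b f) = fock_norm p f"
proof -
  have hol: "weyl a b f holomorphic_on UNIV"
    using assms by (auto simp: fock_space_iff intro!: holomorphic_weyl)
  have eq: "fock_mod (weyl a b f) z = 1 * fock_mod f (a * z + b)" for z
    by (simp add: fock_mod_weyl assms)
  show "weyl a b f \<in> fock_space p" "fock_norm p (weyl a b f) = fock_norm p f"
    using fock_isometry[OF assms(1,2) hol assms(3) _ eq] by auto
qed

lemma fock_cmult: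
  assumes "p \<ge> 1" "f \<in> fock_space p"
  shows "(\<lambda>z. c * f z) \<in> fock_space p" "fock_norm p (\<lambda>z. c * f z) = cmod c * fock_norm p f"
proof -
  have hol: "(\<lambda>z. c * f z) holomorphic_on UNIV"
    using assms by (auto simp: fock_space_iff intro!: holomorphic_intros)
  have eq: "fock_mod (\<lambda>z. c * f z) z = cmod c * fock_mod f (1 * z + 0)" for z
    by (simp add: fock_mod_def norm_mult)
  show "(\<lambda>z. c * f z) \<in> fock_space p" "fock_norm p (\<lambda>z. c * f z) = cmod c * fock_norm p f"
    by (rule fock_isometry[OF assms hol _ _ eq]; simp)+
qed

lemma fock_norm_minus_commute: "fock_norm p (\<lambda>x. f x - g x) = fock_norm p (\<lambda>x. g x - f x)"
  by (simp add: fock_norm_def norm_minus_commute)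

lemma fock_norm_zero [simp]: "fock_norm p (\<lambda>_. 0) = 0"
  by (simp add: fock_norm_def)

lemma fock_zero_mem [simp]: "(\<lambda>_. 0) \<in> fock_space p"
  by (simp add: fock_space_iff fock_int_def fock_mod_def)

lemma fock_const_mem:
  assumes "p \<ge> 1" shows "(\<lambda>_. c) \<in> fock_space p"
proof -
  have "(\<lambda>_. 1) \<in> fock_space p"
    using nn_integral_gaussian_complex[of "p / 2"] assms
    by (simp add: fock_space_iff fock_int_def fock_mod_def exp_powr_real mult.commute)
  from fock_cmult(1)[OF assms this, of c] show ?thesis by simp
qed

text \<open>Half of the Gaussian weight absorbs the growth of z. This function becomes the second
  eigenfunction of a rotation.\<close>

lemma fock_ident_mem:
  assumes "p \<ge> 1" shows "(\<lambda>z. z) \<in> fock_space p"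
proof -
  have "fock_int p (\<lambda>z. z) \<le> (\<integral>\<^sup>+z. ennreal (exp (- (p / 4) * (cmod z)\<^sup>2)) \<partial>lborel)"
    unfolding fock_int_def
  proof (intro nn_integral_mono ennreal_leI)
    fix z :: complex
    have "0 \<le> (cmod z / 2 - 1)\<^sup>2" by simp
    hence "cmod z \<le> 1 + (cmod z)\<^sup>2 / 4"
      by (simp add: power2_eq_square algebra_simps)
    also have "\<dots> \<le> exp ((cmod z)\<^sup>2 / 4)" by (rule exp_ge_add_one_self)
    finally have "fock_mod (\<lambda>z. z) z \<le> exp ((cmod z)\<^sup>2 / 4) * exp (- (cmod z)\<^sup>2 / 2)"
      unfolding fock_mod_def by (intro mult_right_mono) auto
    also have "\<dots> = exp (- (cmod z)\<^sup>2 / 4)"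
      by (simp add: exp_add[symmetric])
    finally have "fock_mod (\<lambda>z. z) z powr p \<le> exp (- (cmod z)\<^sup>2 / 4) powr p"
      using assms by (intro powr_mono2) auto
    thus "fock_mod (\<lambda>z. z) z powr p \<le> exp (- (p / 4) * (cmod z)\<^sup>2)"
      by (simp add: exp_powr_real mult.commute)
  qed
  also have "\<dots> < \<infinity>" using assms by (intro nn_integral_gaussian_complex) simp
  finally show ?thesis by (simp add: fock_space_iff)
qed

subsection \<open>Point evaluations and the triangle inequality\<close>

text \<open>Cauchy's formula at 0 for z -> f(z w) on the unit circle. Writing the circle as
  rotations of w prepares the exchange with a rotation invariant integral over w.\<close>

lemma circle_mean_le:
  assumes f: "f holomorphic_on UNIV"
  shows "ennreal (cmod (f 0)) \<le>
    (\<integral>\<^sup>+t. ennreal (cmod (f (exp (2 * of_real pi * \<i> * of_real t) * w))) * indicator {0..1} t \<partial>lborel)"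
proof -
  define e where "e = (\<lambda>t. exp (2 * of_real pi * \<i> * of_real t) :: complex)"
  define g where "g = (\<lambda>z. f (z * w))"
  have g: "g holomorphic_on UNIV"
  proof -
    have "(f \<circ> (\<lambda>z. z * w)) holomorphic_on UNIV"
      by (rule holomorphic_on_compose_gen[OF _ f]) (auto intro!: holomorphic_intros)
    thus ?thesis by (simp add: g_def o_def)
  qed
  have "((\<lambda>u. g u / (u - 0)) has_contour_integral (2 * of_real pi * \<i> * g 0)) (circlepath 0 1)"
    by (rule Cauchy_integral_circlepath_simple) (use g holomorphic_on_subset in auto)
  hence "((\<lambda>t. g (circlepath 0 1 t) / (circlepath 0 1 t - 0) *
            vector_derivative (circlepath 0 1) (at t within {0..1})) has_integral (2 * of_real pi * \<i> * g 0)) {0..1}"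
    by (simp add: has_contour_integral_def)
  hence "((\<lambda>t. 2 * of_real pi * \<i> * g (e t)) has_integral (2 * of_real pi * \<i> * g 0)) {0..1}"
  proof (rule has_integral_eq[rotated])
    fix t :: real assume "t \<in> {0..1}"
    hence "vector_derivative (circlepath 0 1) (at t within {0..1}) = 2 * of_real pi * \<i> * e t"
      using vector_derivative_circlepath01[of t 0 1] by (simp add: e_def)
    moreover have "circlepath 0 1 t = e t" by (simp add: circlepath e_def)
    moreover have "e t \<noteq> 0" by (simp add: e_def)
    ultimately show "g (circlepath 0 1 t) / (circlepath 0 1 t - 0) *
        vector_derivative (circlepath 0 1) (at t within {0..1}) = 2 * of_real pi * \<i> * g (e t)"
      by simp
  qed
  hence 1: "((\<lambda>t. g (e t)) has_integral g 0) {0..1}"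
  proof -
    have *: "(h has_integral I) S"
      if "((\<lambda>t. c * h t) has_integral c * I) S" "c \<noteq> 0" for c I and h :: "real \<Rightarrow> complex" and S
    proof -
      have "inverse c * (c * x) = x" for x
      proof -
        have "inverse c * (c * x) = inverse c * c * x" by (rule mult.assoc[symmetric])
        thus ?thesis using that(2) by simp
      qed
      thus ?thesis using has_integral_mult_right[OF that(1), of "inverse c"] by (simp only:)
    qed
    assume "((\<lambda>t. 2 * of_real pi * \<i> * g (e t)) has_integral (2 * of_real pi * \<i> * g 0)) {0..1}"
    thus ?thesis by (rule *) simp
  qed
  have "continuous_on {0..1} e" unfolding e_def by (intro continuous_intros)
  from continuous_on_compose2[OF holomorphic_on_imp_continuous_on[OF g] this]
  have "continuous_on {0..1} (\<lambda>t. cmod (g (e t)))"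
    by (intro continuous_on_norm) simp
  hence 2: "(\<lambda>t. cmod (g (e t))) integrable_on {0..1}"
    by (rule integrable_continuous_real)
  have "ennreal (cmod (f 0)) = ennreal (cmod (integral {0..1} (\<lambda>t. g (e t))))"
    using integral_unique[OF 1] by (simp add: g_def)
  also have "\<dots> \<le> ennreal (integral {0..1} (\<lambda>t. cmod (g (e t))))"
    by (intro ennreal_leI integral_norm_bound_integral has_integral_integrable[OF 1] 2) simp
  also have "\<dots> = (\<integral>\<^sup>+t. ennreal (cmod (g (e t))) * indicator {0..1} t \<partial>lborel)"
    by (rule nn_integral_has_integral_lebesgue'[symmetric, OF _ integrable_integral[OF 2]]) simp
  finally show ?thesis by (simp add: g_def e_def)
qed

text \<open>Averaging the circle mean over the rotation invariant Gaussian weight yields a bound for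
  \<open>f 0\<close> by the weighted \<open>L\<^sup>1\<close> norm, and \<open>\<bar>f\<bar> \<le> 1 + \<bar>f\<bar>\<^sup>p\<close> turns this into an \<open>L\<^sup>p\<close> bound.\<close>

lemma fock_value_at_0_le:
  assumes p: "p \<ge> 1"
  shows "\<exists>K\<ge>0. \<forall>f\<in>fock_space p. cmod (f 0) \<le> 1 + K * fock_norm p f powr p"
proof -
  define \<phi> where "\<phi> = (\<lambda>z::complex. exp (- p * (cmod z)\<^sup>2 / 2))"
  define e where "e = (\<lambda>t. exp (2 * of_real pi * \<i> * of_real t) :: complex)"
  define G where "G = (\<integral>\<^sup>+z. ennreal (\<phi> z) \<partial>lborel)"
  have \<phi>_meas [measurable]: "\<phi> \<in> borel_measurable borel"
    unfolding \<phi>_def by (intro borel_measurable_continuous_onI continuous_intros) auto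
  have \<phi>0: "0 < \<phi> z" for z by (simp add: \<phi>_def)
  have e1: "cmod (e t) = 1" for t by (simp add: e_def)
  have \<phi>e: "\<phi> (e t * z) = \<phi> z" for t z by (simp add: \<phi>_def norm_mult e1)
  have Gfin: "G < \<infinity>"
    using nn_integral_gaussian_complex[of "p / 2"] p by (simp add: G_def \<phi>_def mult.commute)
  have "G \<noteq> 0"
  proof
    assume "G = 0"
    hence "emeasure lborel {z::complex. ennreal (\<phi> z) \<noteq> 0} = 0"
      unfolding G_def by (subst (asm) nn_integral_0_iff) auto
    moreover have "{z::complex. ennreal (\<phi> z) \<noteq> 0} = UNIV"
      using \<phi>0 by (auto simp: ennreal_eq_0_iff not_le)
    ultimately show False by simp
  qed
  define r where "r = enn2real G"
  have r: "G = ennreal r" "r > 0"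
    using Gfin \<open>G \<noteq> 0\<close> by (auto simp: r_def enn2real_positive_iff less_top zero_less_iff_neq_zero)
  \<comment> \<open>After division by the mass r of the Gaussian, the summand \<phi> gives 1, and
    \<open>fock_int p f\<close>, which lacks the normalising factor of the norm, gives the
    rest.\<close>
  have "cmod (f 0) \<le> 1 + (2 * pi / p / r) * fock_norm p f powr p" if f: "f \<in> fock_space p" for f
  proof -
    have hol: "f holomorphic_on UNIV" using f by (simp add: fock_space_iff)
    have fm [measurable]: "f \<in> borel_measurable borel"
      by (rule holomorphic_borel_measurable[OF hol])
    have em [measurable]: "e \<in> borel_measurable borel"
      unfolding e_def by (intro borel_measurable_continuous_onI continuous_intros)
    define F where "F = (\<lambda>z. ennreal (\<phi> z * cmod (f z)))"
    have Fm [measurable]: "F \<in> borel_measurable borel" unfolding F_def by measurable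
    have "ennreal (cmod (f 0)) * G = (\<integral>\<^sup>+z. ennreal (\<phi> z) * ennreal (cmod (f 0)) \<partial>lborel)"
      unfolding G_def by (subst nn_integral_multc) (auto simp: mult.commute)
    also have "\<dots> \<le> (\<integral>\<^sup>+z. \<integral>\<^sup>+t. F (e t * z) * indicator {0..1} t \<partial>lborel \<partial>lborel)"
    proof (rule nn_integral_mono)
      fix z :: complex
      have "ennreal (\<phi> z) * ennreal (cmod (f 0)) \<le>
            ennreal (\<phi> z) * (\<integral>\<^sup>+t. ennreal (cmod (f (e t * z))) * indicator {0..1} t \<partial>lborel)"
        unfolding e_def by (intro mult_left_mono circle_mean_le hol) auto
      also have "\<dots> = (\<integral>\<^sup>+t. ennreal (\<phi> z) * (ennreal (cmod (f (e t * z))) * indicator {0..1} t) \<partial>lborel)"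
        by (rule nn_integral_cmult[symmetric]) measurable
      also have "\<dots> = (\<integral>\<^sup>+t. F (e t * z) * indicator {0..1} t \<partial>lborel)"
        using \<phi>0 by (intro nn_integral_cong)
           (auto simp: F_def \<phi>e ennreal_mult less_imp_le mult.assoc)
      finally show "ennreal (\<phi> z) * ennreal (cmod (f 0)) \<le> \<dots>" .
    qed
    also have "\<dots> = (\<integral>\<^sup>+t. \<integral>\<^sup>+z. F (e t * z) * indicator {0..1} t \<partial>lborel \<partial>lborel)"
    proof -
      have "(\<lambda>q. e (snd q) * fst q) \<in> borel_measurable (lborel \<Otimes>\<^sub>M lborel)"
        unfolding e_def lborel_prod measurable_lborel2
        by (intro borel_measurable_continuous_onI continuous_intros)
      from measurable_compose[OF this Fm]
      have "(\<lambda>(z, t). F (e t * z) * indicator {0..1} t) \<in> borel_measurable (lborel \<Otimes>\<^sub>M lborel)"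
        by (simp add: case_prod_unfold)
      thus ?thesis by (rule lborel_pair.Fubini'[symmetric])
    qed
    also have "\<dots> = (\<integral>\<^sup>+t. (\<integral>\<^sup>+z. F z \<partial>lborel) * indicator {0..1::real} t \<partial>lborel)"
      by (intro nn_integral_cong) (subst nn_integral_multc, auto simp: nn_integral_complex_rotate e1)
    also have "\<dots> = (\<integral>\<^sup>+z. F z \<partial>lborel)"
      by (subst nn_integral_cmult) auto
    also have "\<dots> \<le> (\<integral>\<^sup>+z. ennreal (\<phi> z) + ennreal (fock_mod f z powr p) \<partial>lborel)"
    proof (rule nn_integral_mono)
      fix z :: complex
      have "cmod (f z) \<le> 1 + cmod (f z) powr p"
      proof (cases "cmod (f z) \<le> 1")
        case False
        hence "cmod (f z) powr 1 \<le> cmod (f z) powr p" using p by (intro powr_mono) auto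
        with False show ?thesis by simp
      qed (simp add: add_increasing2)
      hence "\<phi> z * cmod (f z) \<le> \<phi> z * (1 + cmod (f z) powr p)"
        using \<phi>0[of z] by (intro mult_left_mono) auto
      also have "\<dots> = \<phi> z + fock_mod f z powr p"
        by (simp add: \<phi>_def fock_mod_powr[symmetric] algebra_simps)
      finally show "F z \<le> ennreal (\<phi> z) + ennreal (fock_mod f z powr p)"
        using \<phi>0[of z] unfolding F_def
          by (simp add: ennreal_plus[symmetric] ennreal_leI del: ennreal_plus)
    qed
    also have "\<dots> = G + fock_int p f"
      unfolding G_def fock_int_def by (rule nn_integral_add) measurable
    also have "\<dots> = ennreal (r + 2 * pi / p * fock_norm p f powr p)"
      using r p f by (simp add: fock_int_eq_norm ennreal_plus[symmetric] del: ennreal_plus)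
    finally have "cmod (f 0) * r \<le> r + 2 * pi / p * fock_norm p f powr p"
      using r p by (simp add: ennreal_mult[symmetric] ennreal_plus[symmetric] del: ennreal_plus)
    hence "cmod (f 0) * r / r \<le> (r + 2 * pi / p * fock_norm p f powr p) / r"
      using r(2) by (intro divide_right_mono) auto
    thus ?thesis
      using r(2) p by (simp add: add_divide_distrib)
  qed
  thus ?thesis
    using r(2) p by (intro exI[of _ "2 * pi / p / r"]) auto
qed

text \<open>The inhomogeneous bound at 0 becomes linear by scaling f to norm 1; if the norm is 0,
  arbitrarily large multiples of f obey the same bound, so f(0) = 0. A Weyl translation then moves z
  to 0 without changing the norm.\<close>

lemma fock_mod_le:
  assumes p: "p \<ge> 1"
  shows "\<exists>C>0. \<forall>f\<in>fock_space p. \<forall>z. fock_mod f z \<le> C * fock_norm p f"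
proof -
  obtain K where K: "K \<ge> 0" "\<And>f. f \<in> fock_space p \<Longrightarrow> cmod (f 0) \<le> 1 + K * fock_norm p f powr p"
    using fock_value_at_0_le[OF p] by blast
  have 0: "cmod (f 0) \<le> (1 + K) * fock_norm p f" if f: "f \<in> fock_space p" for f
  proof (cases "fock_norm p f = 0")
    case True
    have le: "c * cmod (f 0) \<le> 1" if "c > 0" for c
      using K(2)[OF fock_cmult(1)[OF p f, of "of_real c"]] fock_cmult(2)[OF p f, of "of_real c"] True that p
      by (simp add: norm_mult)
    have "f 0 = 0"
    proof (rule ccontr)
      assume "f 0 \<noteq> 0"
      thus False using le[of "2 / cmod (f 0)"] by auto
    qed
    thus ?thesis using True by simp
  next
    case False
    define s where "s = fock_norm p f"
    have s: "s > 0" using False fock_norm_nonneg[of p f] unfolding s_def by linarith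
    have "fock_norm p (\<lambda>z. of_real (1 / s) * f z) = 1"
      using fock_cmult(2)[OF p f, of "of_real (1 / s)"] s by (simp add: s_def[symmetric] norm_divide)
    with K(2)[OF fock_cmult(1)[OF p f, of "of_real (1 / s)"]]
    have "cmod (f 0) / s \<le> 1 + K" using s by (simp add: norm_mult norm_divide)
    thus ?thesis using s by (simp add: s_def[symmetric] field_simps)
  qed
  have "fock_mod f z \<le> (1 + K) * fock_norm p f" if f: "f \<in> fock_space p" for f z
    using 0[OF weyl_isometry(1)[OF p f, of 1 z]] weyl_isometry(2)[OF p f, of 1 z]
      fock_mod_weyl[of 1 z f 0] by (simp add: fock_mod_def)
  thus ?thesis using K(1) by (intro exI[of _ "1 + K"]) auto
qed

lemma fock_norm_eq_0:
  assumes "p \<ge> 1" "f \<in> fock_space p" "fock_norm p f = 0"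
  shows "f = (\<lambda>_. 0)"
proof
  fix z
  obtain C where "fock_mod f z \<le> C * fock_norm p f" using fock_mod_le assms by blast
  hence "fock_mod f z = 0" using assms(3) fock_mod_nonneg[of f z] by simp
  thus "f z = 0" by (simp add: fock_mod_def)
qed

section \<open>Minkowski's inequality from convexity\<close>

lemma powr_convex_comb:
  fixes x y p s t :: real
  assumes "p \<ge> 1" "x \<ge> 0" "y \<ge> 0" "s > 0" "t > 0"
  shows "((x + y) / (s + t)) powr p \<le> s / (s + t) * (x / s) powr p + t / (s + t) * (y / t) powr p"
proof -
  have aux: "(u * x) powr p \<le> u * x powr p" if "0 \<le> u" "u \<le> 1" "0 \<le> x" for u x :: real
  proof -
    have "u powr p \<le> u powr 1" if "u > 0" using that \<open>u \<le> 1\<close> assms(1) by (intro powr_mono') auto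
    hence "u powr p \<le> u" using \<open>0 \<le> u\<close> by (cases "u = 0") auto
    thus ?thesis using that by (simp add: powr_mult mult_right_mono)
  qed
  have st: "s / (s + t) + t / (s + t) = 1" using assms by (simp add: add_divide_distrib[symmetric])
  have comb: "(x + y) / (s + t) = s / (s + t) * (x / s) + t / (s + t) * (y / t)"
    using assms by (simp add: add_divide_distrib)
  consider "x = 0" | "y = 0" | "x > 0" "y > 0" using assms by linarith
  thus ?thesis
  proof cases
    case 1 thus ?thesis unfolding comb using aux[of "t / (s + t)" "y / t"] assms by auto
  next
    case 2 thus ?thesis unfolding comb using aux[of "s / (s + t)" "x / s"] assms by auto
  next
    case 3
    have "s / (s + t) = 1 - t / (s + t)" using st by linarith
    thus ?thesis
      unfolding comb
      using convex_onD[OF powr_convex[OF assms(1)], of "t / (s + t)" "x / s" "y / t"] 3 assms by simp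
  qed
qed

text \<open>Convexity is applied with weights proportional to the norms of f and g. Both must be
  positive; norm 0 forces the zero function by the point evaluation bound.\<close>

lemma fock_add:
  assumes p: "p \<ge> 1" and f: "f \<in> fock_space p" and g: "g \<in> fock_space p"
  shows "(\<lambda>z. f z + g z) \<in> fock_space p"
    and "fock_norm p (\<lambda>z. f z + g z) \<le> fock_norm p f + fock_norm p g"
proof -
  have "(\<lambda>z. f z + g z) \<in> fock_space p \<and> fock_norm p (\<lambda>z. f z + g z) \<le> fock_norm p f + fock_norm p g"
  proof (cases "fock_norm p f = 0 \<or> fock_norm p g = 0")
    case True
    thus ?thesis using fock_norm_eq_0[OF p f] fock_norm_eq_0[OF p g] f g by auto
  next
    case False
    define s t where "s = fock_norm p f" and "t = fock_norm p g"
    have s: "s > 0" and t: "t > 0"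
      using False fock_norm_nonneg[of p f] fock_norm_nonneg[of p g] unfolding s_def t_def by linarith+
    have hol: "f holomorphic_on UNIV" "g holomorphic_on UNIV" using f g by (auto simp: fock_space_iff)
    note [measurable] = holomorphic_borel_measurable[OF hol(1)] holomorphic_borel_measurable[OF hol(2)]
    \<comment> \<open>The coefficients left when the convexity inequality is multiplied by
      \<open>(s + t) powr p\<close>; after integration they add up to exactly that power.\<close>
    define c d where "c = (s + t) powr p * (s / (s + t)) / s powr p"
      and "d = (s + t) powr p * (t / (s + t)) / t powr p"
    have cd: "c \<ge> 0" "d \<ge> 0" using s t by (auto simp: c_def d_def)
    have le: "fock_mod (\<lambda>z. f z + g z) z powr p \<le> c * fock_mod f z powr p + d * fock_mod g z powr p" for z
    proof -
      let ?x = "fock_mod f z" and ?y = "fock_mod g z"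
      have "fock_mod (\<lambda>z. f z + g z) z \<le> ?x + ?y"
        unfolding fock_mod_def distrib_right[symmetric] by (intro mult_right_mono norm_triangle_ineq) auto
      hence "fock_mod (\<lambda>z. f z + g z) z powr p \<le> (?x + ?y) powr p"
        using p by (intro powr_mono2) auto
      also have "\<dots> = (s + t) powr p * ((?x + ?y) / (s + t)) powr p"
        using s t by (simp add: powr_divide)
      also have "\<dots> \<le> (s + t) powr p * (s / (s + t) * (?x / s) powr p + t / (s + t) * (?y / t) powr p)"
        by (intro mult_left_mono powr_convex_comb p s t) auto
      also have "\<dots> = c * ?x powr p + d * ?y powr p"
        using s t by (simp add: c_def d_def powr_divide distrib_left)
      finally show ?thesis .
    qed
    have "fock_int p (\<lambda>z. f z + g z) \<le> (\<integral>\<^sup>+z. ennreal c * ennreal (fock_mod f z powr p)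
             + ennreal d * ennreal (fock_mod g z powr p) \<partial>lborel)"
      unfolding fock_int_def using cd le
      by (intro nn_integral_mono) (simp add: ennreal_mult[symmetric] ennreal_plus[symmetric] del: ennreal_plus)
    also have "\<dots> = ennreal c * fock_int p f + ennreal d * fock_int p g"
      unfolding fock_int_def by (subst nn_integral_add) (simp_all add: nn_integral_cmult)
    also have "\<dots> = ennreal (2 * pi / p * (c * s powr p + d * t powr p))"
      using cd p f g s t unfolding fock_int_eq_norm[OF p f] fock_int_eq_norm[OF p g]
      by (simp add: ennreal_mult[symmetric] ennreal_plus[symmetric] s_def[symmetric] t_def[symmetric] algebra_simps
               del: ennreal_plus)
    also have "c * s powr p + d * t powr p = (s + t) powr p * ((s + t) / (s + t))"
      using s t unfolding c_def d_def add_divide_distrib distrib_left by simp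
    also have "\<dots> = (s + t) powr p" using s t by simp
    finally have I: "fock_int p (\<lambda>z. f z + g z) \<le> ennreal (2 * pi / p * (s + t) powr p)" .
    hence mem: "(\<lambda>z. f z + g z) \<in> fock_space p"
      using hol by (auto simp: fock_space_iff le_less_trans intro!: holomorphic_intros)
    with fock_norm_leI[OF p mem I] s t show ?thesis by (simp add: s_def t_def)
  qed
  thus "(\<lambda>z. f z + g z) \<in> fock_space p"
    and "fock_norm p (\<lambda>z. f z + g z) \<le> fock_norm p f + fock_norm p g" by auto
qed

subsection \<open>Ritt's condition on Banach spaces of functions\<close>

text \<open>\<open>norm_nonneg\<close> and \<open>norm_diff_commute\<close> have no membership
  premise, because \<open>Metric_space\<close> asks for nonnegativity and symmetry of the distance
  at all points.\<close>

locale function_banach_space =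
  fixes V :: "('a \<Rightarrow> complex) set" and N :: "('a \<Rightarrow> complex) \<Rightarrow> real"
  assumes zero_mem: "(\<lambda>_. 0) \<in> V"
    and add_mem: "f \<in> V \<Longrightarrow> g \<in> V \<Longrightarrow> (\<lambda>x. f x + g x) \<in> V"
    and scale_mem: "f \<in> V \<Longrightarrow> (\<lambda>x. c * f x) \<in> V"
    and norm_nonneg: "0 \<le> N f"
    and norm_0: "N (\<lambda>_. 0) = 0"
    and norm_eq_0D: "f \<in> V \<Longrightarrow> N f = 0 \<Longrightarrow> f = (\<lambda>_. 0)"
    and norm_scale: "f \<in> V \<Longrightarrow> N (\<lambda>x. c * f x) = cmod c * N f"
    and norm_triangle: "f \<in> V \<Longrightarrow> g \<in> V \<Longrightarrow> N (\<lambda>x. f x + g x) \<le> N f + N g"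
    and norm_diff_commute: "N (\<lambda>x. f x - g x) = N (\<lambda>x. g x - f x)"
    and complete: "(\<And>n. \<sigma> n \<in> V) \<Longrightarrow>
      (\<And>e. e > 0 \<Longrightarrow> \<exists>k. \<forall>m\<ge>k. \<forall>n\<ge>k. N (\<lambda>x. \<sigma> m x - \<sigma> n x) < e) \<Longrightarrow>
      \<exists>f\<in>V. (\<lambda>n. N (\<lambda>x. \<sigma> n x - f x)) \<longlonglongrightarrow> 0"
begin

lemma diff_mem: "f \<in> V \<Longrightarrow> g \<in> V \<Longrightarrow> (\<lambda>x. f x - g x) \<in> V"
  using add_mem[of f "\<lambda>x. -1 * g x"] scale_mem[of g "-1"] by simp

lemma norm_le_add:
  assumes "g \<in> V" "h \<in> V" "\<And>x. f x = g x + h x"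
  shows "N f \<le> N g + N h"
proof -
  have "f = (\<lambda>x. g x + h x)" using assms(3) by auto
  thus ?thesis using norm_triangle assms by simp
qed

lemma norm_diff_triangle:
  assumes "f \<in> V" "g \<in> V" "h \<in> V"
  shows "N (\<lambda>x. f x - h x) \<le> N (\<lambda>x. f x - g x) + N (\<lambda>x. g x - h x)"
  by (rule norm_le_add) (auto intro!: diff_mem assms)

sublocale Metric_space V "\<lambda>f g. N (\<lambda>x. f x - g x)"
proof
  fix f g assume fg: "f \<in> V" "g \<in> V"
  show "N (\<lambda>x. f x - g x) = 0 \<longleftrightarrow> f = g"
  proof
    assume "N (\<lambda>x. f x - g x) = 0"
    hence "(\<lambda>x. f x - g x) = (\<lambda>_. 0)" by (rule norm_eq_0D[OF diff_mem[OF fg]])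
    thus "f = g" by (simp add: fun_eq_iff)
  qed (simp add: norm_0)
qed (fact norm_nonneg norm_diff_commute norm_diff_triangle)+

lemma mcomplete: mcomplete
  unfolding mcomplete_def
proof (intro allI impI)
  fix \<sigma> assume \<sigma>: "MCauchy \<sigma>"
  hence "range \<sigma> \<subseteq> V" by (simp only: MCauchy_def)
  hence mem: "\<sigma> n \<in> V" for n by (simp add: image_subset_iff)
  have "\<exists>k. \<forall>m\<ge>k. \<forall>n\<ge>k. N (\<lambda>x. \<sigma> m x - \<sigma> n x) < e" if "e > 0" for e
  proof -
    from \<sigma> that obtain k where "\<forall>m n. k \<le> m \<longrightarrow> k \<le> n \<longrightarrow> N (\<lambda>x. \<sigma> m x - \<sigma> n x) < e"
      by (auto simp only: MCauchy_def)
    thus ?thesis by (intro exI[of _ k]) simp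
  qed
  from complete[OF mem this] obtain f where f: "f \<in> V" "(\<lambda>n. N (\<lambda>x. \<sigma> n x - f x)) \<longlonglongrightarrow> 0" ..
  have "limitin mtopology \<sigma> f sequentially"
    unfolding limitin_metric_dist_null using mem f by simp
  thus "\<exists>f. limitin mtopology \<sigma> f sequentially" by (intro exI[of _ f])
qed

text \<open>Solves the linear equations below by contraction, so that no operator series has to be
  summed.\<close>

lemma fixed_point:
  assumes "\<And>f. f \<in> V \<Longrightarrow> F f \<in> V" "q < 1"
    "\<And>f g. f \<in> V \<Longrightarrow> g \<in> V \<Longrightarrow> N (\<lambda>x. F f x - F g x) \<le> q * N (\<lambda>x. f x - g x)"
  shows "\<exists>f\<in>V. F f = f"
proof -
  have "V \<noteq> {}" "F \<in> V \<rightarrow> V" using zero_mem assms(1) by auto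
  from Banach_fixedpoint_thm[OF mcomplete this assms(2,3)] obtain f where "f \<in> V" "F f = f" .
  thus ?thesis by (intro bexI)
qed

section \<open>The operators \<open>\<mu> - T\<close> for bounded T\<close>

definition pencil :: "(('a \<Rightarrow> complex) \<Rightarrow> 'a \<Rightarrow> complex) \<Rightarrow> complex \<Rightarrow> ('a \<Rightarrow> complex) \<Rightarrow> 'a \<Rightarrow> complex" where
  "pencil T \<mu> f = (\<lambda>x. \<mu> * f x - T f x)"

context
  fixes T :: "('a \<Rightarrow> complex) \<Rightarrow> 'a \<Rightarrow> complex"
  assumes T: "bounded_op_on V N T"
begin

lemma op_mem: "f \<in> V \<Longrightarrow> T f \<in> V"
  and op_add: "f \<in> V \<Longrightarrow> g \<in> V \<Longrightarrow> T (\<lambda>x. f x + g x) = (\<lambda>x. T f x + T g x)"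
  and op_scale: "f \<in> V \<Longrightarrow> T (\<lambda>x. c * f x) = (\<lambda>x. c * T f x)"
  using T by (auto simp: bounded_op_on_def)

lemma op_diff: "f \<in> V \<Longrightarrow> g \<in> V \<Longrightarrow> T (\<lambda>x. f x - g x) = (\<lambda>x. T f x - T g x)"
  using op_add[of f "\<lambda>x. -1 * g x"] op_scale[of g "-1"] scale_mem[of g "-1"] by simp

lemma op_bound: "\<exists>C\<ge>0. \<forall>f\<in>V. N (T f) \<le> C * N f"
proof -
  obtain C where C: "\<forall>f\<in>V. N (T f) \<le> C * N f" using T by (auto simp: bounded_op_on_def)
  have "N (T f) \<le> max C 0 * N f" if "f \<in> V" for f
    using C that mult_right_mono[OF max.cobounded1[of C 0] norm_nonneg[of f]] by force
  thus ?thesis by (intro exI[of _ "max C 0"]) auto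
qed

lemma pencil_mem: "f \<in> V \<Longrightarrow> pencil T \<mu> f \<in> V"
  unfolding pencil_def by (intro diff_mem scale_mem op_mem)

lemma pencil_diff:
  "f \<in> V \<Longrightarrow> g \<in> V \<Longrightarrow> pencil T \<mu> (\<lambda>x. f x - g x) = (\<lambda>x. pencil T \<mu> f x - pencil T \<mu> g x)"
  by (auto simp: pencil_def op_diff algebra_simps)

lemma pencil_add:
  "f \<in> V \<Longrightarrow> g \<in> V \<Longrightarrow> pencil T \<mu> (\<lambda>x. f x + g x) = (\<lambda>x. pencil T \<mu> f x + pencil T \<mu> g x)"
  by (auto simp: pencil_def op_add algebra_simps)

lemma pencil_scale: "f \<in> V \<Longrightarrow> pencil T \<mu> (\<lambda>x. c * f x) = (\<lambda>x. c * pencil T \<mu> f x)"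
  by (auto simp: pencil_def op_scale algebra_simps)

lemma inj_on_pencil:
  assumes "\<And>f. f \<in> V \<Longrightarrow> N f \<le> K * N (pencil T \<mu> f)"
  shows "inj_on (pencil T \<mu>) V"
proof (rule inj_onI)
  fix f g assume fg: "f \<in> V" "g \<in> V" "pencil T \<mu> f = pencil T \<mu> g"
  have "N (\<lambda>x. f x - g x) \<le> K * N (\<lambda>_. 0)"
    using assms[OF diff_mem[OF fg(1,2)]] fg by (simp add: pencil_diff)
  thus "f = g" using zero[OF fg(1,2)] norm_nonneg[of "\<lambda>x. f x - g x"] by (simp add: norm_0)
qed

text \<open>The lower bound at f = R g is the upper bound K for the inverse R, and injectivity makes
  R linear.\<close>

lemma in_resolvent_setI:
  assumes K: "0 \<le> K" "\<And>f. f \<in> V \<Longrightarrow> N f \<le> K * N (pencil T \<mu> f)"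
    and surj: "\<And>g. g \<in> V \<Longrightarrow> \<exists>f\<in>V. pencil T \<mu> f = g"
  shows "in_resolvent_set_on V N T \<mu>" "onorm_on V N (resolvent_on V T \<mu>) \<le> K"
proof -
  define R where "R = resolvent_on V T \<mu>"
  have bij: "bij_betw (pencil T \<mu>) V V"
    using inj_on_pencil[OF K(2)] surj pencil_mem by (auto simp: bij_betw_def)
  have R: "R = inv_into V (pencil T \<mu>)"
    by (simp add: R_def resolvent_on_def pencil_def[abs_def])
  have R_mem: "R g \<in> V" and R_eq: "pencil T \<mu> (R g) = g" if "g \<in> V" for g
    using bij that inv_into_into[of g "pencil T \<mu>" V] f_inv_into_f[of g "pencil T \<mu>" V]
    unfolding R by (auto simp: bij_betw_def)
  have R_inv: "R (pencil T \<mu> f) = f" if "f \<in> V" for f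
    using bij that unfolding R by (simp add: bij_betw_def inv_into_f_f)
  have R_bound: "N (R g) \<le> K * N g" if "g \<in> V" for g
    using K(2)[OF R_mem[OF that]] R_eq[OF that] by simp
  have "R (\<lambda>x. f x + g x) = (\<lambda>x. R f x + R g x)" if "f \<in> V" "g \<in> V" for f g
    using R_inv[OF add_mem[OF R_mem[OF that(1)] R_mem[OF that(2)]]] that
    by (simp add: pencil_add R_mem R_eq)
  moreover have "R (\<lambda>x. c * f x) = (\<lambda>x. c * R f x)" if "f \<in> V" for c f
    using R_inv[OF scale_mem[OF R_mem[OF that], of c]] that by (simp add: pencil_scale R_mem R_eq)
  ultimately have "bounded_op_on V N R"
    using R_mem R_bound unfolding bounded_op_on_def by (intro conjI exI[of _ K]) auto
  thus "in_resolvent_set_on V N T \<mu>"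
    using bij by (simp add: in_resolvent_set_on_def R_def pencil_def[abs_def])
  have "N (R f) / N f \<le> K" if "f \<in> V" for f
    using R_bound[OF that] K(1) norm_nonneg[of f] by (cases "N f = 0") (auto simp: field_simps)
  thus "onorm_on V N (resolvent_on V T \<mu>) \<le> K"
    unfolding onorm_on_def R_def using zero_mem by (intro cSUP_least) auto
qed

text \<open>Under the lower bound, surjectivity of \<open>\<mu> - T\<close> at \<open>\<nu>\<close> propagates to a ball around \<open>\<nu>\<close> whose
  radius is proportional to \<open>\<bar>\<nu>\<bar>\<close>; so it descends from the large \<open>\<mu>\<close>, where the Neumann series
  converges, to all \<open>\<bar>\<mu>\<bar> \<ge> 1\<close>.\<close>

lemma pencil_surj_step:
  assumes k: "k > 0" "\<And>f. f \<in> V \<Longrightarrow> k * N f \<le> N (pencil T \<nu> f)"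
    and surj: "\<And>g. g \<in> V \<Longrightarrow> \<exists>f\<in>V. pencil T \<nu> f = g"
    and close: "cmod (\<mu> - \<nu>) < k" and g: "g \<in> V"
  shows "\<exists>f\<in>V. pencil T \<mu> f = g"
proof -
  obtain R where R: "\<And>h. h \<in> V \<Longrightarrow> R h \<in> V" "\<And>h. h \<in> V \<Longrightarrow> pencil T \<nu> (R h) = h"
    using surj by metis
  \<comment> \<open>The equation \<open>pencil T \<mu> f = g\<close> is equivalent to
    \<open>pencil T \<nu> f = S f\<close>, hence to the fixed point equation f = R (S f).\<close>
  define S where "S f = (\<lambda>x. g x - (\<mu> - \<nu>) * f x)" for f :: "'a \<Rightarrow> complex"
  have S: "S f \<in> V" if "f \<in> V" for f unfolding S_def by (intro diff_mem scale_mem g that)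
  have lip: "N (\<lambda>x. R (S f) x - R (S h) x) \<le> cmod (\<mu> - \<nu>) / k * N (\<lambda>x. f x - h x)"
    if fh: "f \<in> V" "h \<in> V" for f h
  proof -
    have "k * N (\<lambda>x. R (S f) x - R (S h) x) \<le> N (\<lambda>x. S f x - S h x)"
      using k(2)[OF diff_mem[OF R(1)[OF S[OF fh(1)]] R(1)[OF S[OF fh(2)]]]] fh
      by (simp add: pencil_diff R S)
    also have "(\<lambda>x. S f x - S h x) = (\<lambda>x. (\<nu> - \<mu>) * (f x - h x))"
      by (auto simp: S_def algebra_simps)
    also have "N (\<lambda>x. (\<nu> - \<mu>) * (f x - h x)) = cmod (\<mu> - \<nu>) * N (\<lambda>x. f x - h x)"
      using norm_scale[OF diff_mem[OF fh]] by (simp add: norm_minus_commute)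
    finally show ?thesis using k(1) by (simp add: field_simps)
  qed
  have "\<exists>f\<in>V. R (S f) = f"
  proof (rule fixed_point[where F = "\<lambda>f. R (S f)" and q = "cmod (\<mu> - \<nu>) / k"])
    show "R (S f) \<in> V" if "f \<in> V" for f by (intro R S that)
    show "cmod (\<mu> - \<nu>) / k < 1" using close k(1) by (simp add: divide_less_eq_1)
  qed (rule lip)
  then obtain f where f: "f \<in> V" "R (S f) = f" by blast
  have "pencil T \<nu> f = S f" using R(2)[OF S[OF f(1)]] f(2) by simp
  hence "\<nu> * f x - T f x = g x - (\<mu> - \<nu>) * f x" for x
    unfolding pencil_def S_def by (rule fun_cong)
  hence "pencil T \<mu> f = g" by (auto simp: pencil_def algebra_simps)
  thus ?thesis using f(1) by blast
qed

text \<open>A solution is a fixed point of f -> (g + T f) / \<mu>, a contraction with constant C /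
  |\<mu>|.\<close>

lemma pencil_surj_large:
  assumes C: "0 \<le> C" "\<And>f. f \<in> V \<Longrightarrow> N (T f) \<le> C * N f" and \<mu>: "cmod \<mu> > C" and g: "g \<in> V"
  shows "\<exists>f\<in>V. pencil T \<mu> f = g"
proof -
  define S where "S f = (\<lambda>x. (1 / \<mu>) * (g x + T f x))" for f
  have \<mu>0: "\<mu> \<noteq> 0" using \<mu> C(1) by auto
  have lip: "N (\<lambda>x. S f x - S h x) \<le> C / cmod \<mu> * N (\<lambda>x. f x - h x)" if fh: "f \<in> V" "h \<in> V" for f h
  proof -
    have eq: "(\<lambda>x. S f x - S h x) = (\<lambda>x. (1 / \<mu>) * (T (\<lambda>y. f y - h y) x))"
      by (auto simp: S_def op_diff fh diff_divide_distrib add_divide_distrib)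
    have "N (\<lambda>x. S f x - S h x) = cmod (1 / \<mu>) * N (T (\<lambda>y. f y - h y))"
      unfolding eq by (rule norm_scale) (intro op_mem diff_mem fh)
    also have "\<dots> \<le> cmod (1 / \<mu>) * (C * N (\<lambda>y. f y - h y))"
      by (intro mult_left_mono C diff_mem fh) auto
    finally show ?thesis by (simp add: norm_divide)
  qed
  have "\<exists>f\<in>V. S f = f"
  proof (rule fixed_point[where F = S and q = "C / cmod \<mu>"])
    show "S f \<in> V" if "f \<in> V" for f
      unfolding S_def by (intro scale_mem add_mem g op_mem that)
    show "C / cmod \<mu> < 1" using \<mu> C(1) by (simp add: divide_less_eq_1)
  qed (rule lip)
  then obtain f where f: "f \<in> V" "S f = f" by blast
  have "(1 / \<mu>) * (g x + T f x) = f x" for x using fun_cong[OF f(2)] by (simp add: S_def)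
  hence "g x + T f x = \<mu> * f x" for x 
    using \<mu>0 by (simp add: field_simps)
  hence "pencil T \<mu> f = g" by (simp add: pencil_def fun_eq_iff eq_diff_eq diff_eq_eq)
  thus ?thesis using f(1) by blast
qed

section \<open>Ritt's condition and lower bounds\<close>

lemma ritt_conditionI:
  assumes d: "d > 0" "\<And>\<mu> f. cmod \<mu> \<ge> 1 \<Longrightarrow> f \<in> V \<Longrightarrow> d * cmod \<mu> * N f \<le> N (pencil T \<mu> f)"
  shows "ritt_condition_on V N T"
proof -
  obtain C where C: "C \<ge> 0" "\<And>f. f \<in> V \<Longrightarrow> N (T f) \<le> C * N f" using op_bound by blast
  \<comment> \<open>Passing from r \<nu> down to \<nu> covers the distance (d/2) |\<nu>|, less than
    the admissible radius d r |\<nu>|. Starting beyond C takes finitely many steps.\<close>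
  define r where "r = 1 + d / 2"
  have r: "r > 1" using d by (simp add: r_def)
  have surj: "\<forall>g\<in>V. \<exists>f\<in>V. pencil T \<mu> f = g" if \<mu>: "cmod \<mu> \<ge> 1" for \<mu>
  proof -
    obtain n where n: "C < r ^ n" using real_arch_pow[OF r] by blast
    have "\<forall>g\<in>V. \<exists>f\<in>V. pencil T (of_real (r ^ k) * \<mu>) f = g" if "k \<le> n" for k
      using that
    proof (induction rule: inc_induct)
      case base
      have "C < cmod (of_real (r ^ n) * \<mu>)"
        using n r less_le_trans[OF n, of "r ^ n * cmod \<mu>"] mult_left_mono[OF \<mu>, of "r ^ n"]
        by (simp add: norm_mult norm_power)
      thus ?case using pencil_surj_large[OF C] by blast
    next
      case (step k)
      let ?\<nu> = "of_real (r ^ Suc k) * \<mu>" and ?\<mu> = "of_real (r ^ k) * \<mu>"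
      have 1: "cmod ?\<mu> \<ge> 1"
        using r mult_mono[OF one_le_power[of r k] \<mu>] by (simp add: norm_mult norm_power)
      have \<nu>: "cmod ?\<nu> = r * cmod ?\<mu>" using r by (simp add: norm_mult norm_power)
      have 2: "cmod ?\<nu> \<ge> 1" unfolding \<nu> using r mult_mono[OF less_imp_le[OF r] 1] by simp
      have "?\<mu> - ?\<nu> = of_real (1 - r) * ?\<mu>" by (simp add: algebra_simps)
      hence "cmod (?\<mu> - ?\<nu>) = \<bar>1 - r\<bar> * cmod ?\<mu>"
        by (simp only: norm_mult norm_of_real)
      also have "\<bar>1 - r\<bar> = d / 2" using d(1) by (simp add: r_def)
      also have "d / 2 * cmod ?\<mu> < d * cmod ?\<mu>"
        using d(1) less_le_trans[OF zero_less_one 1] by (intro mult_strict_right_mono) auto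
      also have "\<dots> \<le> d * cmod ?\<nu>"
        unfolding \<nu> using r d(1) mult_right_mono[of 1 r "cmod ?\<mu>"] by (intro mult_left_mono) auto
      finally have 3: "cmod (?\<mu> - ?\<nu>) < d * cmod ?\<nu>" .
      have "d * cmod ?\<nu> > 0" using d 2 by (intro mult_pos_pos) linarith+
      from pencil_surj_step[OF this d(2)[OF 2] _ 3] step.IH show ?case by blast
    qed
    from this[of 0] show ?thesis by simp
  qed
  have res: "in_resolvent_set_on V N T \<mu>" "onorm_on V N (resolvent_on V T \<mu>) \<le> 1 / (d * cmod \<mu>)"
    if \<mu>: "cmod \<mu> \<ge> 1" for \<mu>
  proof -
    have pos: "d * cmod \<mu> > 0" using d(1) \<mu> by (intro mult_pos_pos) linarith+
    have le: "N f \<le> 1 / (d * cmod \<mu>) * N (pencil T \<mu> f)" if "f \<in> V" for f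
      using d(2)[OF \<mu> that] pos by (simp add: field_simps)
    show "in_resolvent_set_on V N T \<mu>" "onorm_on V N (resolvent_on V T \<mu>) \<le> 1 / (d * cmod \<mu>)"
      using in_resolvent_setI[OF _ le] pos surj[OF \<mu>] by auto
  qed
  \<comment> \<open>Since |\<mu> - 1| \<le> 2 |\<mu>|, the bound 1 / (d |\<mu>|) has Ritt's form
    with M = 2 / d.\<close>
  have "onorm_on V N (resolvent_on V T \<mu>) \<le> (2 / d) / cmod (\<mu> - 1)" if \<mu>: "cmod \<mu> > 1" for \<mu>
  proof -
    have "cmod (\<mu> - 1) \<le> 2 * cmod \<mu>" using norm_triangle_ineq4[of \<mu> 1] \<mu> by simp
    moreover have "cmod (\<mu> - 1) > 0" using \<mu> by auto
    moreover have "(2 / d) / (2 * cmod \<mu>) = 1 / (d * cmod \<mu>)" by simp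
    moreover have "cmod (\<mu> - 1) * (2 * cmod \<mu>) > 0" using \<mu> by (intro mult_pos_pos) auto
    ultimately have "1 / (d * cmod \<mu>) \<le> (2 / d) / cmod (\<mu> - 1)"
      using d(1) divide_left_mono[of "cmod (\<mu> - 1)" "2 * cmod \<mu>" "2 / d"]
      by (simp add: mult.commute)
    thus ?thesis using res(2)[of \<mu>] \<mu> by linarith
  qed
  thus ?thesis unfolding ritt_condition_on_def
    using T res(1) d(1) by (intro conjI allI impI exI[of _ "2 / d"]) auto
qed

text \<open>The exceptional case u = 1. The criterion \<open>ritt_conditionI\<close> cannot serve
  here, because the pencil vanishes at \<mu> = 1.\<close>

lemma ritt_condition_identity:
  assumes id: "\<And>f. T f = f"
  shows "ritt_condition_on V N T"
proof -
  have pencil: "pencil T \<mu> f = (\<lambda>x. (\<mu> - 1) * f x)" for \<mu> f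
    by (simp add: pencil_def id algebra_simps)
  have "in_resolvent_set_on V N T \<mu> \<and> onorm_on V N (resolvent_on V T \<mu>) \<le> 1 / cmod (\<mu> - 1)"
    if \<mu>: "cmod \<mu> > 1" for \<mu>
  proof -
    have \<mu>1: "\<mu> - 1 \<noteq> 0" using \<mu> by auto
    have le: "N f \<le> 1 / cmod (\<mu> - 1) * N (pencil T \<mu> f)" if "f \<in> V" for f
      unfolding pencil norm_scale[OF that] using \<mu>1 by simp
    have surj: "\<exists>f\<in>V. pencil T \<mu> f = g" if "g \<in> V" for g
      using scale_mem[OF that, of "1 / (\<mu> - 1)"] \<mu>1 unfolding pencil
      by (intro bexI[of _ "\<lambda>x. 1 / (\<mu> - 1) * g x"]) auto
    show ?thesis using in_resolvent_setI[OF _ le surj] by simp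
  qed
  thus ?thesis unfolding ritt_condition_on_def
    using T by (intro conjI allI impI exI[of _ 1]) auto
qed

text \<open>Outside the closed disc this is the resolvent bound with denominators cleared. In this
  form both sides are continuous in \<mu>, and t \<mu> with t decreasing to 1 reaches the unit
  circle.\<close>

lemma ritt_condition_lower_bound:
  assumes "ritt_condition_on V N T"
  shows "\<exists>M>0. \<forall>\<mu>. cmod \<mu> \<ge> 1 \<longrightarrow> (\<forall>f\<in>V. cmod (\<mu> - 1) * N f \<le> M * N (pencil T \<mu> f))"
proof -
  obtain M where M: "M > 0"
    "\<And>\<mu>. cmod \<mu> > 1 \<Longrightarrow> onorm_on V N (resolvent_on V T \<mu>) \<le> M / cmod (\<mu> - 1)"
    and res: "\<And>\<mu>. cmod \<mu> > 1 \<Longrightarrow> in_resolvent_set_on V N T \<mu>"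
    using assms unfolding ritt_condition_on_def by blast
  have outside: "cmod (\<mu> - 1) * N f \<le> M * N (pencil T \<mu> f)" if \<mu>: "cmod \<mu> > 1" and f: "f \<in> V" for \<mu> f
  proof -
    define R where "R = resolvent_on V T \<mu>"
    have bij: "bij_betw (pencil T \<mu>) V V" and bd: "bounded_op_on V N R"
      using res[OF \<mu>] by (simp_all add: in_resolvent_set_on_def R_def pencil_def[abs_def])
    have "R = inv_into V (pencil T \<mu>)" by (simp add: R_def resolvent_on_def pencil_def[abs_def])
    hence Rf: "R (pencil T \<mu> f) = f" using bij f by (simp add: bij_betw_def inv_into_f_f)
    have pos: "cmod (\<mu> - 1) > 0" using \<mu> by auto
    show ?thesis
    proof (cases "N (pencil T \<mu> f) = 0")
      case True
      hence "pencil T \<mu> f = (\<lambda>_. 0)" by (intro norm_eq_0D pencil_mem f)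
      also have "\<dots> = pencil T \<mu> (\<lambda>_. 0)" using pencil_scale[OF zero_mem, of \<mu> 0] by simp
      finally have "f = (\<lambda>_. 0)" using bij f zero_mem by (auto simp: bij_betw_def inj_on_def)
      thus ?thesis using M(1) norm_nonneg by (simp add: norm_0)
    next
      case False
      hence Np: "N (pencil T \<mu> f) > 0" using norm_nonneg[of "pencil T \<mu> f"] by linarith
      obtain C where C: "\<forall>g\<in>V. N (R g) \<le> C * N g" using bd by (auto simp: bounded_op_on_def)
      \<comment> \<open>The real supremum in \<open>onorm_on\<close> dominates the quotients only
        once they are known to be bounded above.\<close>
      have "N (R g) / N g \<le> max C 0" if "g \<in> V" for g
      proof -
        have "N (R g) \<le> max C 0 * N g"
          using bspec[OF C that] mult_right_mono[OF max.cobounded1[of C 0] norm_nonneg[of g]] by linarith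
        thus ?thesis using norm_nonneg[of g] by (cases "N g = 0") (auto simp: divide_le_eq)
      qed
      hence "bdd_above ((\<lambda>g. N (R g) / N g) ` V)" by (intro bdd_aboveI2[of _ _ "max C 0"])
      hence "N (R (pencil T \<mu> f)) / N (pencil T \<mu> f) \<le> onorm_on V N R"
        unfolding onorm_on_def by (intro cSUP_upper pencil_mem f)
      also have "\<dots> \<le> M / cmod (\<mu> - 1)" using M(2)[OF \<mu>] by (simp add: R_def)
      finally show ?thesis using Np pos by (simp add: Rf field_simps)
    qed
  qed
  have "cmod (\<mu> - 1) * N f \<le> M * N (pencil T \<mu> f)" if \<mu>: "cmod \<mu> \<ge> 1" and f: "f \<in> V" for \<mu> f
  proof (rule tendsto_le[OF trivial_limit_at_right_real[of 1]])
    have "((\<lambda>t::real. cmod (of_real t * \<mu> - 1) * N f) \<longlongrightarrow> cmod (of_real 1 * \<mu> - 1) * N f) (at_right 1)"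
      by (intro tendsto_intros)
    thus "((\<lambda>t::real. cmod (of_real t * \<mu> - 1) * N f) \<longlongrightarrow> cmod (\<mu> - 1) * N f) (at_right 1)" by simp
    have "((\<lambda>t::real. M * ((t - 1) * cmod \<mu> * N f + N (pencil T \<mu> f))) \<longlongrightarrow>
            M * ((1 - 1) * cmod \<mu> * N f + N (pencil T \<mu> f))) (at_right 1)"
      by (intro tendsto_intros)
    thus "((\<lambda>t::real. M * ((t - 1) * cmod \<mu> * N f + N (pencil T \<mu> f))) \<longlongrightarrow> M * N (pencil T \<mu> f)) (at_right 1)"
      by simp
    show "\<forall>\<^sub>F t in at_right 1. cmod (of_real t * \<mu> - 1) * N f \<le>
            M * ((t - 1) * cmod \<mu> * N f + N (pencil T \<mu> f))"
      using eventually_at_right_less[of "1::real"]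
    proof eventually_elim
      fix t :: real assume t: "1 < t"
      have "1 * 1 < t * cmod \<mu>" using t \<mu> by (intro mult_less_le_imp_less) auto
      hence "cmod (of_real t * \<mu>) > 1" using t by (simp add: norm_mult)
      from outside[OF this f] have "cmod (of_real t * \<mu> - 1) * N f \<le> M * N (pencil T (of_real t * \<mu>) f)" .
      also have "N (pencil T (of_real t * \<mu>) f) \<le> N (\<lambda>x. (of_real (t - 1) * \<mu>) * f x) + N (pencil T \<mu> f)"
        by (rule norm_le_add[OF scale_mem[OF f] pencil_mem[OF f]]) (simp add: pencil_def algebra_simps)
      also have "N (\<lambda>x. (of_real (t - 1) * \<mu>) * f x) = (t - 1) * cmod \<mu> * N f"
        using t by (subst norm_scale[OF f], subst norm_mult, subst norm_of_real) simp
      finally show "cmod (of_real t * \<mu> - 1) * N f \<le> M * ((t - 1) * cmod \<mu> * N f + N (pencil T \<mu> f))"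
        using M(1) by (simp add: mult_left_mono)
    qed
  qed
  thus ?thesis using M(1) by blast
qed

section \<open>Compact operators\<close>

lemma compact_op_subseq:
  assumes comp: "compact_op_on V N T" and f: "\<And>n. f n \<in> V" "\<And>n. N (f n) \<le> 1"
  shows "\<exists>l\<in>V. \<exists>r::nat\<Rightarrow>nat. strict_mono r \<and> (\<lambda>n. N (\<lambda>x. T (f (r n)) x - l x)) \<longlonglongrightarrow> 0"
proof -
  define S where "S = mtopology closure_of (T ` {f\<in>V. N f \<le> 1})"
  have "compactin mtopology S"
    using comp unfolding compact_op_on_def S_def by (simp add: Let_def)
  hence seq: "\<forall>\<sigma>::nat \<Rightarrow> _. range \<sigma> \<subseteq> S \<longrightarrow>
      (\<exists>l r. l \<in> S \<and> strict_mono r \<and> limitin mtopology (\<sigma> \<circ> r) l sequentially)"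
    unfolding compactin_sequentially by simp
  have "T ` {f\<in>V. N f \<le> 1} \<subseteq> S"
    unfolding S_def by (rule closure_of_subset) (auto intro: op_mem)
  hence "range (\<lambda>n. T (f n)) \<subseteq> S" using f by auto
  from seq[rule_format, OF this] obtain l r
    where "strict_mono r" "limitin mtopology ((\<lambda>n. T (f n)) \<circ> r) l sequentially"
    by (elim exE conjE)
  thus ?thesis unfolding limitin_metric_dist_null o_def by (intro bexI[of _ l] exI[of _ r]) simp_all
qed

text \<open>If no d works, there are unit vectors f n with (\<mu> n - T)(f n) small relative to
  |\<mu> n|. Compactness makes T (f n) converge along a subsequence to some l, and l turns out to be
  an eigenvector.\<close>

lemma compact_lower_bound:
  assumes comp: "compact_op_on V N T"
    and ker: "\<And>\<mu> f. cmod \<mu> \<ge> 1 \<Longrightarrow> f \<in> V \<Longrightarrow> pencil T \<mu> f = (\<lambda>_. 0) \<Longrightarrow> f = (\<lambda>_. 0)"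
  shows "\<exists>d>0. \<forall>\<mu> f. cmod \<mu> \<ge> 1 \<longrightarrow> f \<in> V \<longrightarrow> d * cmod \<mu> * N f \<le> N (pencil T \<mu> f)"
proof (rule ccontr)
  assume no: "\<not> ?thesis"
  have "\<exists>\<mu> f. cmod \<mu> \<ge> 1 \<and> f \<in> V \<and> N f = 1 \<and> N (pencil T \<mu> f) < 1 / real (Suc n) * cmod \<mu>" for n
  proof -
    have "1 / real (Suc n) > 0" by simp
    with no have "\<not> (\<forall>\<mu> f. cmod \<mu> \<ge> 1 \<longrightarrow> f \<in> V \<longrightarrow> 1 / real (Suc n) * cmod \<mu> * N f \<le> N (pencil T \<mu> f))"
      by blast
    then obtain \<mu> f where \<mu>: "cmod \<mu> \<ge> 1" and f: "f \<in> V"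
      and less: "N (pencil T \<mu> f) < 1 / real (Suc n) * cmod \<mu> * N f"
      unfolding not_all not_imp not_le by (elim exE conjE)
    have Nf: "N f > 0"
      using less norm_nonneg[of "pencil T \<mu> f"] norm_nonneg[of f] by (cases "N f = 0") auto
    define g where "g = (\<lambda>x. of_real (1 / N f) * f x)"
    have g: "g \<in> V" "N g = 1"
      using scale_mem[OF f, of "of_real (1 / N f)"] norm_scale[OF f, of "of_real (1 / N f)"] Nf
      by (simp_all add: g_def norm_divide)
    have "pencil T \<mu> g = (\<lambda>x. of_real (1 / N f) * pencil T \<mu> f x)"
      unfolding g_def by (rule pencil_scale[OF f])
    hence "N (pencil T \<mu> g) = 1 / N f * N (pencil T \<mu> f)"
      using norm_scale[OF pencil_mem[OF f], of "of_real (1 / N f)" \<mu>] Nf by (simp add: norm_divide)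
    hence "N (pencil T \<mu> g) < 1 / real (Suc n) * cmod \<mu>"
      using mult_strict_left_mono[OF less, of "1 / N f"] Nf by simp
    thus ?thesis using \<mu> g by blast
  qed
  then obtain \<mu> f where \<mu>: "\<And>n. cmod (\<mu> n) \<ge> 1" and f: "\<And>n. f n \<in> V" "\<And>n. N (f n) = 1"
    and less: "\<And>n. N (pencil T (\<mu> n) (f n)) < 1 / real (Suc n) * cmod (\<mu> n)"
    by metis
  \<comment> \<open>The \<mu> n may be unbounded, but their reciprocals stay in the compact unit
    disc.\<close>
  define \<nu> where "\<nu> n = 1 / \<mu> n" for n
  have \<mu>0: "\<mu> n \<noteq> 0" for n using \<mu>[of n] by auto
  have \<nu>: "cmod (\<nu> n) \<le> 1" for n using \<mu>[of n] by (simp add: \<nu>_def norm_divide divide_le_eq_1)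
  have near: "N (\<lambda>x. f n x - \<nu> n * T (f n) x) \<le> 1 / real (Suc n)" for n
  proof -
    have eq: "(\<lambda>x. f n x - \<nu> n * T (f n) x) = (\<lambda>x. \<nu> n * pencil T (\<mu> n) (f n) x)"
      using \<mu>0[of n] by (simp add: \<nu>_def pencil_def diff_divide_distrib)
    have "N (\<lambda>x. f n x - \<nu> n * T (f n) x) = 1 / cmod (\<mu> n) * N (pencil T (\<mu> n) (f n))"
      unfolding eq by (subst norm_scale[OF pencil_mem[OF f(1)]]) (simp add: \<nu>_def norm_divide)
    also have "\<dots> \<le> 1 / real (Suc n)"
      using less[of n] \<mu>0[of n] by (simp add: field_simps)
    finally show ?thesis .
  qed
  obtain l r where l: "l \<in> V" and r: "strict_mono (r::nat\<Rightarrow>nat)"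
    and lim1: "(\<lambda>n. N (\<lambda>x. T (f (r n)) x - l x)) \<longlonglongrightarrow> 0"
    using compact_op_subseq[of f, OF comp f(1)] f(2) by auto
  have "compact (cball (0::complex) 1)" by simp
  moreover have "\<forall>n. (\<nu> \<circ> r) n \<in> cball 0 1" using \<nu> by simp
  ultimately obtain c r' where r': "strict_mono (r'::nat\<Rightarrow>nat)" and c: "c \<in> cball 0 1"
    and lim2: "((\<nu> \<circ> r) \<circ> r') \<longlonglongrightarrow> c"
    unfolding compact_def by blast
  define s where "s = r \<circ> r'"
  have s: "strict_mono s" unfolding s_def using r r' by (rule strict_mono_o)
  have limT: "(\<lambda>n. N (\<lambda>x. T (f (s n)) x - l x)) \<longlonglongrightarrow> 0"
    using LIMSEQ_subseq_LIMSEQ[OF lim1 r'] by (simp add: s_def o_def)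
  have lim\<nu>: "(\<lambda>n. \<nu> (s n)) \<longlonglongrightarrow> c" using lim2 by (simp add: s_def o_def)
  have limf: "(\<lambda>n. N (\<lambda>x. f (s n) x - c * l x)) \<longlonglongrightarrow> 0"
  proof (rule tendsto_sandwich[OF always_eventually always_eventually])
    show "\<forall>n. 0 \<le> N (\<lambda>x. f (s n) x - c * l x)" by (simp add: norm_nonneg)
    show "\<forall>n. N (\<lambda>x. f (s n) x - c * l x) \<le>
        1 / real (Suc (s n)) + (N (\<lambda>x. T (f (s n)) x - l x) + cmod (\<nu> (s n) - c) * N l)"
    proof
      fix n
      let ?m = "s n"
      have 1: "(\<lambda>x. f ?m x - \<nu> ?m * T (f ?m) x) \<in> V" "(\<lambda>x. T (f ?m) x - l x) \<in> V"
        by (intro diff_mem scale_mem op_mem f l)+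
      have 2: "(\<lambda>x. \<nu> ?m * (T (f ?m) x - l x)) \<in> V" "(\<lambda>x. (\<nu> ?m - c) * l x) \<in> V"
        by (intro scale_mem 1 l)+
      have "N (\<lambda>x. f ?m x - c * l x) \<le> N (\<lambda>x. f ?m x - \<nu> ?m * T (f ?m) x)
          + N (\<lambda>x. \<nu> ?m * (T (f ?m) x - l x) + (\<nu> ?m - c) * l x)"
        by (rule norm_le_add[OF 1(1) add_mem[OF 2]]) (simp add: algebra_simps)
      also have "N (\<lambda>x. \<nu> ?m * (T (f ?m) x - l x) + (\<nu> ?m - c) * l x)
          \<le> N (\<lambda>x. \<nu> ?m * (T (f ?m) x - l x)) + N (\<lambda>x. (\<nu> ?m - c) * l x)"
        by (rule norm_triangle[OF 2])
      also have "N (\<lambda>x. \<nu> ?m * (T (f ?m) x - l x)) = cmod (\<nu> ?m) * N (\<lambda>x. T (f ?m) x - l x)"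
        by (rule norm_scale[OF 1(2)])
      also have "\<dots> \<le> 1 * N (\<lambda>x. T (f ?m) x - l x)"
        by (intro mult_right_mono \<nu> norm_nonneg)
      also have "N (\<lambda>x. (\<nu> ?m - c) * l x) = cmod (\<nu> ?m - c) * N l"
        by (rule norm_scale[OF l])
      finally show "N (\<lambda>x. f ?m x - c * l x) \<le>
        1 / real (Suc ?m) + (N (\<lambda>x. T (f ?m) x - l x) + cmod (\<nu> ?m - c) * N l)"
        using near[of ?m] by simp
    qed
    have "(\<lambda>n. 1 / real (Suc n)) \<longlonglongrightarrow> 0" by real_asymp
    from LIMSEQ_subseq_LIMSEQ[OF this s] have "(\<lambda>n. 1 / real (Suc (s n))) \<longlonglongrightarrow> 0" by (simp only: o_def)
    moreover have "(\<lambda>n. cmod (\<nu> (s n) - c) * N l) \<longlonglongrightarrow> 0"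
      using tendsto_mult[OF tendsto_norm[OF Lim_null[THEN iffD1, OF lim\<nu>]] tendsto_const[of "N l"]] by simp
    ultimately have "(\<lambda>n. 1 / real (Suc (s n)) + (N (\<lambda>x. T (f (s n)) x - l x) + cmod (\<nu> (s n) - c) * N l))
        \<longlonglongrightarrow> 0 + (0 + 0)"
      using limT by (intro tendsto_add)
    thus "(\<lambda>n. 1 / real (Suc (s n)) + (N (\<lambda>x. T (f (s n)) x - l x) + cmod (\<nu> (s n) - c) * N l)) \<longlonglongrightarrow> 0"
      by simp
  qed simp
  have cl: "(\<lambda>x. c * l x) \<in> V" by (rule scale_mem[OF l])
  \<comment> \<open>The limit of unit vectors has norm at least 1. This excludes c = 0, the case
    where |\<mu>| tends to infinity along the subsequence.\<close>
  have "1 \<le> N (\<lambda>x. f (s n) x - c * l x) + N (\<lambda>x. c * l x)" for n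
    using norm_le_add[OF diff_mem[OF f(1) cl] cl, of "f (s n)" "s n"] f(2) by simp
  hence "1 \<le> 0 + N (\<lambda>x. c * l x)"
    by (intro LIMSEQ_le_const[OF tendsto_add[OF limf tendsto_const]]) auto
  hence ge: "1 \<le> cmod c * N l" by (simp add: norm_scale[OF l])
  hence c0: "c \<noteq> 0" by auto
  obtain C where C: "C \<ge> 0" "\<And>f. f \<in> V \<Longrightarrow> N (T f) \<le> C * N f" using op_bound by blast
  \<comment> \<open>T (f n) tends to l by choice and to c T l by continuity of T, so l has the
    eigenvalue 1 / c.\<close>
  have "N (\<lambda>x. l x - c * T l x) \<le> N (\<lambda>x. T (f (s n)) x - l x) + C * N (\<lambda>x. f (s n) x - c * l x)" for n
  proof -
    let ?F = "f (s n)"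
    have d: "(\<lambda>x. ?F x - c * l x) \<in> V" by (intro diff_mem f cl)
    have Td: "T (\<lambda>x. ?F x - c * l x) = (\<lambda>x. T ?F x - c * T l x)"
      using op_diff[OF f(1) cl] by (simp add: op_scale l)
    have "N (\<lambda>x. l x - c * T l x) \<le> N (\<lambda>x. l x - T ?F x) + N (T (\<lambda>x. ?F x - c * l x))"
      by (rule norm_le_add[OF diff_mem[OF l op_mem[OF f(1)]] op_mem[OF d]]) (simp add: Td)
    also have "\<dots> \<le> N (\<lambda>x. T ?F x - l x) + C * N (\<lambda>x. ?F x - c * l x)"
      using C(2)[OF d] norm_diff_commute[of l "T ?F"] by simp
    finally show ?thesis .
  qed
  hence "N (\<lambda>x. l x - c * T l x) \<le> 0 + C * 0"
    by (intro LIMSEQ_le_const[OF tendsto_add[OF limT tendsto_mult[OF tendsto_const limf]]]) auto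
  hence "N (\<lambda>x. l x - c * T l x) = 0" using norm_nonneg[of "\<lambda>x. l x - c * T l x"] by simp
  hence "(\<lambda>x. l x - c * T l x) = (\<lambda>_. 0)"
    by (intro norm_eq_0D diff_mem scale_mem op_mem l)
  hence "l x = c * T l x" for x by (simp add: fun_eq_iff)
  hence "1 / c * l x = T l x" for x using c0 by (metis nonzero_mult_div_cancel_left times_divide_eq_left mult_1)
  hence "pencil T (1 / c) l = (\<lambda>_. 0)" by (simp add: pencil_def)
  moreover have "cmod (1 / c) \<ge> 1" using c c0 by (simp add: norm_divide)
  ultimately have "l = (\<lambda>_. 0)" using ker l by blast
  with ge show False by (simp add: norm_0)
qed

end

end

subsection \<open>Weighted composition operators on Fock spaces\<close>

text \<open>Point evaluations make a Cauchy sequence locally uniformly Cauchy, so its limit is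
  entire; Fatou's lemma then transfers the norm estimates to the limit.\<close>

lemma fock_complete:
  assumes p: "p \<ge> 1" and mem: "\<And>n. \<sigma> n \<in> fock_space p"
    and cauchy: "\<And>e. e > 0 \<Longrightarrow> \<exists>k. \<forall>m\<ge>k. \<forall>n\<ge>k. fock_norm p (\<lambda>z. \<sigma> m z - \<sigma> n z) < e"
  shows "\<exists>f\<in>fock_space p. (\<lambda>n. fock_norm p (\<lambda>z. \<sigma> n z - f z)) \<longlonglongrightarrow> 0"
proof -
  have diff: "(\<lambda>z. g z - h z) \<in> fock_space p" if "g \<in> fock_space p" "h \<in> fock_space p" for g h
    using fock_add(1)[OF p that(1) fock_cmult(1)[OF p that(2), of "-1"]] by simp
  obtain C where C: "C > 0" "\<And>g z. g \<in> fock_space p \<Longrightarrow> fock_mod g z \<le> C * fock_norm p g"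
    using fock_mod_le[OF p] by blast
  define f where "f = (\<lambda>z. lim (\<lambda>n. \<sigma> n z))"
  have unif: "uniform_limit (cball x 1) \<sigma> f sequentially" for x
  proof -
    \<comment> \<open>The weight is undone at the price of its largest reciprocal on the ball of
      radius 1 about x.\<close>
    define D where "D = C * exp ((cmod x + 1)\<^sup>2 / 2)"
    have D: "D > 0" using C(1) by (simp add: D_def)
    have bnd: "cmod (g z) \<le> D * fock_norm p g" if g: "g \<in> fock_space p" and z: "z \<in> cball x 1" for g z
    proof -
      have "cmod z \<le> cmod x + 1"
        using z norm_triangle_ineq2[of z x] by (simp add: dist_norm norm_minus_commute)
      have "cmod (g z) = fock_mod g z * exp ((cmod z)\<^sup>2 / 2)"
        by (simp add: fock_mod_def exp_minus)
      also have "\<dots> \<le> (C * fock_norm p g) * exp ((cmod x + 1)\<^sup>2 / 2)"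
        using C(1) by (intro mult_mono C(2) g) (auto simp: power_mono \<open>cmod z \<le> cmod x + 1\<close>)
      finally show ?thesis by (simp add: D_def mult_ac)
    qed
    have "uniformly_Cauchy_on (cball x 1) \<sigma>"
      unfolding uniformly_Cauchy_on_def
    proof (intro allI impI)
      fix e :: real assume "e > 0"
      hence "e / D > 0" using D by simp
      from cauchy[OF this] obtain k
        where k: "\<And>m n. m \<ge> k \<Longrightarrow> n \<ge> k \<Longrightarrow> fock_norm p (\<lambda>z. \<sigma> m z - \<sigma> n z) < e / D" by auto
      have "dist (\<sigma> m z) (\<sigma> n z) < e" if "z \<in> cball x 1" "m \<ge> k" "n \<ge> k" for z m n
      proof -
        have "dist (\<sigma> m z) (\<sigma> n z) \<le> D * fock_norm p (\<lambda>z. \<sigma> m z - \<sigma> n z)"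
          using bnd[OF diff[OF mem mem] that(1)] by (simp add: dist_norm)
        also have "\<dots> < D * (e / D)" using k that D by (intro mult_strict_left_mono) auto
        finally show ?thesis using D by simp
      qed
      thus "\<exists>M. \<forall>z\<in>cball x 1. \<forall>m\<ge>M. \<forall>n\<ge>M. dist (\<sigma> m z) (\<sigma> n z) < e" by blast
    qed
    hence "uniformly_convergent_on (cball x 1) \<sigma>" by (rule Cauchy_uniformly_convergent)
    thus ?thesis unfolding uniformly_convergent_uniform_limit_iff f_def .
  qed
  have hol: "f holomorphic_on UNIV"
  proof (rule holomorphic_uniform_sequence)
    show "\<exists>d>0. cball x d \<subseteq> UNIV \<and> uniform_limit (cball x d) \<sigma> f sequentially" for x
      using unif[of x] by (intro exI[of _ 1]) auto
  qed (use mem in \<open>auto simp: fock_space_iff\<close>)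
  have lim: "(\<lambda>n. \<sigma> n z) \<longlonglongrightarrow> f z" for z
    using tendsto_uniform_limitI[OF unif[of z], of z] by simp
  have step: "(\<lambda>z. \<sigma> n z - f z) \<in> fock_space p \<and> fock_norm p (\<lambda>z. \<sigma> n z - f z) \<le> e"
    if e: "e > 0" and k: "\<And>m. m \<ge> k \<Longrightarrow> fock_norm p (\<lambda>z. \<sigma> n z - \<sigma> m z) < e" for e k n
  proof -
    have holn: "(\<lambda>z. \<sigma> n z - f z) holomorphic_on UNIV"
      using mem hol by (auto simp: fock_space_iff intro!: holomorphic_intros)
    have pw: "(\<lambda>m. ennreal (fock_mod (\<lambda>z. \<sigma> n z - \<sigma> m z) z powr p)) \<longlonglongrightarrow>
        ennreal (fock_mod (\<lambda>z. \<sigma> n z - f z) z powr p)" for z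
      unfolding fock_mod_def using p
      by (intro tendsto_ennrealI tendsto_powr' tendsto_mult tendsto_norm tendsto_diff tendsto_const lim) auto
    have "fock_int p (\<lambda>z. \<sigma> n z - f z)
        = (\<integral>\<^sup>+z. liminf (\<lambda>m. ennreal (fock_mod (\<lambda>z. \<sigma> n z - \<sigma> m z) z powr p)) \<partial>lborel)"
      unfolding fock_int_def
      by (intro nn_integral_cong lim_imp_Liminf[symmetric] pw) auto
    also have "\<dots> \<le> liminf (\<lambda>m. fock_int p (\<lambda>z. \<sigma> n z - \<sigma> m z))"
      unfolding fock_int_def
    proof (rule nn_integral_liminf)
      fix m
      have "(\<lambda>z. \<sigma> n z - \<sigma> m z) \<in> borel_measurable borel"
        using diff[OF mem mem, of n m] by (intro holomorphic_borel_measurable) (simp add: fock_space_iff)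
      hence "fock_mod (\<lambda>z. \<sigma> n z - \<sigma> m z) \<in> borel_measurable borel" by (rule fock_mod_measurable)
      thus "(\<lambda>z. ennreal (fock_mod (\<lambda>z. \<sigma> n z - \<sigma> m z) z powr p)) \<in> borel_measurable lborel"
        by measurable
    qed
    also have "\<dots> \<le> ennreal (2 * pi / p * e powr p)"
    proof (rule Liminf_le)
      show "\<forall>\<^sub>F m in sequentially. fock_int p (\<lambda>z. \<sigma> n z - \<sigma> m z) \<le> ennreal (2 * pi / p * e powr p)"
        using eventually_ge_at_top[of k]
      proof eventually_elim
        case (elim m)
        have "fock_norm p (\<lambda>z. \<sigma> n z - \<sigma> m z) powr p \<le> e powr p"
          using k[OF elim] p by (intro powr_mono2) auto
        thus ?case unfolding fock_int_eq_norm[OF p diff[OF mem mem]]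
          using p by (intro ennreal_leI mult_left_mono) auto
      qed
    qed simp
    finally have I: "fock_int p (\<lambda>z. \<sigma> n z - f z) \<le> ennreal (2 * pi / p * e powr p)" .
    hence "(\<lambda>z. \<sigma> n z - f z) \<in> fock_space p"
      using holn by (auto simp: fock_space_iff le_less_trans)
    with fock_norm_leI[OF p this I] e show ?thesis by simp
  qed
  obtain k1 where "\<And>m n. m \<ge> k1 \<Longrightarrow> n \<ge> k1 \<Longrightarrow> fock_norm p (\<lambda>z. \<sigma> m z - \<sigma> n z) < 1"
    using cauchy[of 1] by auto
  with step[of 1 k1 k1] have "(\<lambda>z. \<sigma> k1 z - f z) \<in> fock_space p" by simp
  from diff[OF mem[of k1] this] have fmem: "f \<in> fock_space p" by simp
  have "(\<lambda>n. fock_norm p (\<lambda>z. \<sigma> n z - f z)) \<longlonglongrightarrow> 0"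
  proof (rule LIMSEQ_I)
    fix e :: real assume "e > 0"
    hence e2: "e / 2 > 0" by simp
    from cauchy[OF e2] obtain k
      where k: "\<And>m n. m \<ge> k \<Longrightarrow> n \<ge> k \<Longrightarrow> fock_norm p (\<lambda>z. \<sigma> m z - \<sigma> n z) < e / 2" by auto
    have "norm (fock_norm p (\<lambda>z. \<sigma> n z - f z) - 0) < e" if "n \<ge> k" for n
      using step[OF e2, of k n] k[OF that] \<open>e > 0\<close> by auto
    thus "\<exists>k. \<forall>n\<ge>k. norm (fock_norm p (\<lambda>z. \<sigma> n z - f z) - 0) < e" by blast
  qed
  with fmem show ?thesis by blast
qed

lemma function_banach_space_fock:
  assumes "p \<ge> 1"
  shows "function_banach_space (fock_space p) (fock_norm p)"
  by unfold_locales
     (use assms fock_add fock_cmult fock_norm_eq_0 fock_norm_minus_commute fock_complete in \<open>simp_all\<close>)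

locale fock_weighted_comp =
  fixes p :: real and u :: "complex \<Rightarrow> complex" and a b :: complex
  assumes p: "p \<ge> 1" and u: "u holomorphic_on UNIV"
    and bounded: "bounded_op_on (fock_space p) (fock_norm p) (weighted_comp u (\<lambda>z. a * z + b))"
begin

abbreviation F where "F \<equiv> fock_space p"
abbreviation N where "N \<equiv> fock_norm p"
abbreviation W where "W \<equiv> weighted_comp u (\<lambda>z. a * z + b)"
abbreviation ritt where "ritt \<equiv> ritt_condition_on F N W"
abbreviation one where "one \<equiv> (\<lambda>_::complex. 1::complex)"

sublocale function_banach_space F N
  using p by (rule function_banach_space_fock)

lemma norm_pos:
  assumes "f \<in> F" "f z \<noteq> 0" shows "N f > 0"
proof -
  have "N f \<noteq> 0" using norm_eq_0D[OF assms(1)] assms(2) by auto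
  thus ?thesis using norm_nonneg[of f] by linarith
qed

lemma one_mem: "one \<in> F"
  using p by (rule fock_const_mem)

text \<open>At a fixed point z0 every function u(z0) f - W f vanishes, so the constant 1 is not in
  the range and u(z0) lies in the spectrum.\<close>

lemma ritt_fixed_point:
  assumes ritt and z0: "a * z0 + b = z0"
  shows "cmod (u z0) \<le> 1"
proof (rule ccontr)
  assume "\<not> ?thesis"
  hence "in_resolvent_set_on F N W (u z0)"
    using assms(1) by (simp add: ritt_condition_on_def)
  hence "(\<lambda>f x. u z0 * f x - W f x) ` F = F"
    unfolding in_resolvent_set_on_def bij_betw_def by blast
  with one_mem obtain f where "one = (\<lambda>x. u z0 * f x - W f x)" by blast
  from fun_cong[OF this, of z0] show False by (simp add: weighted_comp_def z0)
qed

text \<open>An eigenfunction to \<open>\<mu>\<close> satisfies \<open>\<bar>f (z)\<bar> \<le> \<bar>u (z)\<bar> \<bar>f (\<psi> (z))\<bar>\<close>, and the orbit of \<open>z\<close>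
  under \<open>\<psi>\<close> tends to \<open>z0\<close>, where \<open>\<bar>u\<bar> < 1\<close>.\<close>

lemma no_eigenfunction:
  assumes a: "cmod a < 1" and z0: "a * z0 + b = z0" and uz0: "cmod (u z0) < 1"
    and \<mu>: "cmod \<mu> \<ge> 1" and f: "f \<in> F" and eig: "pencil W \<mu> f = (\<lambda>_. 0)"
  shows "f = (\<lambda>_. 0)"
proof
  fix z
  have cont: "isCont f x" "isCont u x" for x
    using f u by (auto simp: fock_space_iff holomorphic_on_imp_continuous_on continuous_on_eq_continuous_at[symmetric]
        intro!: continuous_on_interior[of UNIV])
  have le: "cmod (f x) \<le> cmod (u x) * cmod (f (a * x + b))" for x
  proof -
    have "\<mu> * f x = u x * f (a * x + b)"
      using fun_cong[OF eig, of x] by (simp add: pencil_def weighted_comp_def)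
    hence "cmod \<mu> * cmod (f x) = cmod (u x) * cmod (f (a * x + b))" by (simp add: norm_mult[symmetric])
    thus ?thesis using mult_right_mono[OF \<mu>, of "cmod (f x)"] by simp
  qed
  define y where "y n = z0 + a ^ n * (z - z0)" for n
  have y_Suc: "a * y n + b = y (Suc n)" for n
  proof -
    have "a * y n + b = (a * z0 + b) + a * a ^ n * (z - z0)" by (simp add: y_def algebra_simps)
    thus ?thesis by (simp add: z0 y_def)
  qed
  have "(\<lambda>n. z0 + a ^ n * (z - z0)) \<longlonglongrightarrow> z0 + 0 * (z - z0)"
    by (intro tendsto_intros LIMSEQ_power_zero a)
  hence y: "y \<longlonglongrightarrow> z0" by (simp add: y_def[abs_def])
  \<comment> \<open>Midway between |u(z0)| and 1: it bounds |u| on the tail of the orbit, and its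
    powers tend to 0, while f stays bounded there.\<close>
  define \<rho> where "\<rho> = (1 + cmod (u z0)) / 2"
  have \<rho>: "cmod (u z0) < \<rho>" "\<rho> < 1" "0 \<le> \<rho>" using uz0 by (auto simp: \<rho>_def)
  have "(\<lambda>n. cmod (u (y n))) \<longlonglongrightarrow> cmod (u z0)"
    by (intro tendsto_norm isCont_tendsto_compose[OF cont(2)] y)
  from order_tendstoD(2)[OF this \<rho>(1)] obtain k where k: "\<And>n. n \<ge> k \<Longrightarrow> cmod (u (y n)) < \<rho>"
    by (auto simp: eventually_sequentially)
  have pow: "cmod (f (y k)) \<le> \<rho> ^ m * cmod (f (y (k + m)))" for m
  proof (induction m)
    case (Suc m)
    have "cmod (f (y (k + m))) \<le> cmod (u (y (k + m))) * cmod (f (y (Suc (k + m))))"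
      using le[of "y (k + m)"] by (simp add: y_Suc)
    also have "\<dots> \<le> \<rho> * cmod (f (y (Suc (k + m))))"
      using k[of "k + m"] by (intro mult_right_mono) auto
    finally have "\<rho> ^ m * cmod (f (y (k + m))) \<le> \<rho> ^ m * (\<rho> * cmod (f (y (Suc (k + m)))))"
      using \<rho>(3) by (intro mult_left_mono) auto
    with Suc show ?case by (simp add: mult_ac)
  qed simp
  have "(\<lambda>m. cmod (f (y (m + k)))) \<longlonglongrightarrow> cmod (f z0)"
    by (intro tendsto_norm isCont_tendsto_compose[OF cont(1)] LIMSEQ_ignore_initial_segment y)
  from tendsto_mult[OF LIMSEQ_power_zero this, of \<rho>] \<rho>
  have "(\<lambda>m. \<rho> ^ m * cmod (f (y (m + k)))) \<longlonglongrightarrow> 0" by simp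
  hence "cmod (f (y k)) \<le> 0"
    by (rule LIMSEQ_le_const) (use pow in \<open>auto simp: add.commute\<close>)
  hence base: "f (y k) = 0" by simp
  \<comment> \<open>By \<open>le\<close> a zero at one point of the orbit forces a zero at its
    predecessor, hence back to y 0 = z.\<close>
  have "f (y n) = 0" if "n \<le> k" for n
    using that
  proof (induction rule: inc_induct)
    case (step n)
    thus ?case using le[of "y n"] by (simp add: y_Suc)
  qed (rule base)
  from this[of 0] show "f z = 0" by (simp add: y_def)
qed

lemma compact_ritt:
  assumes a: "cmod a < 1" and z0: "a * z0 + b = z0" and uz0: "cmod (u z0) < 1"
    and comp: "compact_op_on F N W"
  shows ritt
proof -
  obtain d where "d > 0" "\<And>\<mu> f. cmod \<mu> \<ge> 1 \<Longrightarrow> f \<in> F \<Longrightarrow> d * cmod \<mu> * N f \<le> N (pencil W \<mu> f)"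
    using compact_lower_bound[OF bounded comp] no_eigenfunction[OF a z0 uz0] by metis
  thus ?thesis by (rule ritt_conditionI[OF bounded])
qed

lemma ritt_eigenvalue:
  assumes ritt and f: "f \<in> F" "f z \<noteq> 0" and eig: "\<And>z. W f z = \<mu> * f z" and \<mu>: "cmod \<mu> \<ge> 1"
  shows "\<mu> = 1"
proof -
  obtain M where "cmod (\<mu> - 1) * N f \<le> M * N (pencil W \<mu> f)"
    using ritt_condition_lower_bound[OF bounded \<open>ritt\<close>] \<mu> f(1) by blast
  also have "pencil W \<mu> f = (\<lambda>_. 0)" by (simp add: pencil_def eig)
  finally have "cmod (\<mu> - 1) * N f \<le> 0" by (simp add: norm_0)
  with norm_pos[OF f] show ?thesis by (simp add: mult_le_0_iff)
qed

text \<open>For |a| = 1 this is the scalar relating W to the isometry \<open>weyl a b\<close>. The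
  thresholds for |u(0)| in part (1) say that its modulus is less than 1.\<close>

definition norm_factor where "norm_factor = u 0 * of_real (exp ((cmod b)\<^sup>2 / 2))"

lemma cmod_norm_factor: "cmod norm_factor = cmod (u 0) * exp ((cmod b)\<^sup>2 / 2)"
  by (simp add: norm_factor_def norm_mult)

section \<open>Symbols with |a| = 1\<close>

context
  assumes a: "cmod a = 1"
begin

lemma u_eq: "u z = u 0 * exp (- a * cnj b * z)"
proof -
  obtain C where C: "C > 0" "\<And>g z. g \<in> F \<Longrightarrow> fock_mod g z \<le> C * N g"
    using fock_mod_le[OF p] by blast
  obtain D where D: "D \<ge> 0" "\<And>g. g \<in> F \<Longrightarrow> N (W g) \<le> D * N g"
    using op_bound[OF bounded] by blast
  define h where "h z = u z * exp (a * cnj b * z)" for z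
  have bnd: "cmod (h z) \<le> C * (D * N one)" for z
  proof -
    define w where "w = a * z + b"
    \<comment> \<open>The kernel is centred at the image w of z, where its weighted modulus is 1.
      The weighted modulus of W ?K at z is then |h(z)| up to a constant factor.\<close>
    let ?K = "weyl 1 (- w) one"
    have K: "?K \<in> F" "N ?K = N one" using weyl_isometry[OF p one_mem] by auto
    have "?K w = exp ((cnj w * w) - of_real ((cmod w)\<^sup>2 / 2))"
      by (simp add: weyl_def)
    also have "cnj w * w = of_real ((cmod w)\<^sup>2)"
      by (simp only: complex_norm_square mult.commute)
    also have "exp (of_real ((cmod w)\<^sup>2) - of_real ((cmod w)\<^sup>2 / 2)) = (of_real (exp ((cmod w)\<^sup>2 / 2)) :: complex)"
      by (simp add: exp_of_real[symmetric] field_simps)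
    finally have Kw: "cmod (?K w) = exp ((cmod w)\<^sup>2 / 2)" by simp
    have "fock_mod (W ?K) z = cmod (u z) * (exp ((cmod w)\<^sup>2 / 2) * exp (- (cmod z)\<^sup>2 / 2))"
      using Kw by (simp add: fock_mod_def weighted_comp_def norm_mult w_def)
    also have "exp ((cmod w)\<^sup>2 / 2) * exp (- (cmod z)\<^sup>2 / 2) = exp (Re (a * cnj b * z)) * exp ((cmod b)\<^sup>2 / 2)"
      unfolding exp_add[symmetric] w_def by (subst cmod_affine_power2[OF a]) (simp add: field_simps)
    also have "cmod (u z) * \<dots> = cmod (h z) * exp ((cmod b)\<^sup>2 / 2)"
      by (simp add: h_def norm_mult)
    finally have "cmod (h z) * exp ((cmod b)\<^sup>2 / 2) = fock_mod (W ?K) z" ..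
    also have "\<dots> \<le> C * N (W ?K)" by (rule C(2)[OF op_mem[OF bounded K(1)]])
    also have "\<dots> \<le> C * (D * N one)"
      using D(2)[OF K(1)] C(1) K(2) by (intro mult_left_mono) auto
    finally have "cmod (h z) * exp ((cmod b)\<^sup>2 / 2) \<le> C * (D * N one)" .
    moreover have "cmod (h z) * 1 \<le> cmod (h z) * exp ((cmod b)\<^sup>2 / 2)"
      by (intro mult_left_mono) auto
    ultimately show ?thesis by linarith
  qed
  have "h holomorphic_on UNIV"
    unfolding h_def[abs_def] using u by (intro holomorphic_intros)
  moreover have "bounded (range h)" using bnd by (auto simp: bounded_iff)
  ultimately have "h constant_on UNIV" by (rule Liouville_theorem)
  hence "h z = h 0" by (auto simp: constant_on_def)
  hence "u z * exp (a * cnj b * z) * exp (- (a * cnj b * z)) = u 0 * exp (- (a * cnj b * z))"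
    by (simp add: h_def)
  thus ?thesis by (simp add: mult.assoc exp_add[symmetric])
qed

lemma W_eq: "W f = (\<lambda>z. norm_factor * weyl a b f z)"
proof
  fix z
  have "norm_factor * exp (- a * cnj b * z - of_real ((cmod b)\<^sup>2 / 2)) = u z"
    unfolding u_eq[of z] norm_factor_def by (simp add: exp_diff exp_of_real[symmetric])
  thus "W f z = norm_factor * weyl a b f z"
    unfolding weighted_comp_def weyl_def by (simp only: mult.assoc[symmetric])
qed

lemma norm_W: "f \<in> F \<Longrightarrow> N (W f) = cmod norm_factor * N f"
  unfolding W_eq using weyl_isometry[OF p _ a] fock_cmult(2)[OF p] by simp

lemma ritt_if_contraction:
  assumes "cmod norm_factor < 1" shows ritt
proof (rule ritt_conditionI[OF bounded])
  show "1 - cmod norm_factor > 0" using assms by simp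
  fix \<mu> :: complex and f assume \<mu>: "cmod \<mu> \<ge> 1" and f: "f \<in> F"
  have "cmod \<mu> * N f = N (\<lambda>x. \<mu> * f x)" by (rule norm_scale[OF f, symmetric])
  also have "\<dots> \<le> N (pencil W \<mu> f) + N (W f)"
    by (rule norm_le_add[OF pencil_mem[OF bounded f] op_mem[OF bounded f]]) (simp add: pencil_def)
  also have "N (W f) \<le> cmod norm_factor * (cmod \<mu> * N f)"
    unfolding norm_W[OF f] using mult_right_mono[OF \<mu> norm_nonneg[of f]] by (intro mult_left_mono) auto
  finally show "(1 - cmod norm_factor) * cmod \<mu> * N f \<le> N (pencil W \<mu> f)" by (simp add: algebra_simps)
qed

text \<open>As |a z0 + b| = |z0|, the expansion of |a z0 + b|^2 determines the real part of the
  exponent of u at z0. So u(z0) can be compared with the threshold.\<close>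

lemma cmod_u_fixed_point:
  assumes z0: "a * z0 + b = z0" shows "cmod (u z0) = cmod norm_factor"
proof -
  have "(cmod z0)\<^sup>2 = (cmod z0)\<^sup>2 + 2 * Re (a * cnj b * z0) + (cmod b)\<^sup>2"
    using cmod_affine_power2[OF a, of z0 b] z0 by simp
  hence "- Re (a * cnj b * z0) = (cmod b)\<^sup>2 / 2" by simp
  thus ?thesis unfolding u_eq[of z0] cmod_norm_factor by (simp add: norm_mult)
qed

text \<open>The two functions used here are eigenfunctions to \<open>u z0\<close> and \<open>a * u z0\<close>, which cannot both
  be \<open>1\<close>.\<close>

lemma not_ritt_rotation:
  assumes z0: "a * z0 + b = z0" and a1: "a \<noteq> 1" and norm_factor: "cmod norm_factor \<ge> 1"
  shows "\<not> ritt"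
proof
  assume ritt
  have aa: "a * cnj a = 1" using a by (simp add: complex_norm_square[symmetric])
  have ab: "a * cnj b = a * cnj z0 - cnj z0"
  proof -
    have "cnj z0 = cnj a * cnj z0 + cnj b" using z0 by (metis complex_cnj_add complex_cnj_mult)
    from arg_cong[OF this, of "\<lambda>x. a * x"]
    have "a * cnj z0 = (a * cnj a) * cnj z0 + a * cnj b" by (simp add: algebra_simps)
    thus ?thesis by (simp add: aa)
  qed
  \<comment> \<open>Conjugated by the Weyl translation to z0, W becomes u(z0) times the rotation g
    -> g(a z), for which 1 and z are eigenfunctions.\<close>
  have E: "u z * weyl 1 (- z0) g (a * z + b) = u z0 * (weyl 1 (- z0) one z * g (a * (z - z0)))" for g z
  proof -
    have arg: "a * z + b - z0 = a * (z - z0)" using z0 by (simp add: algebra_simps)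
    have "- a * cnj b * z + cnj z0 * (a * z + b) = - a * cnj b * z0 + cnj z0 * z"
    proof -
      have "b = z0 - a * z0" using z0 by (simp add: eq_diff_eq add.commute)
      hence "cnj z0 * b = cnj z0 * (z0 - a * z0)" by simp
      also have "\<dots> = - (a * cnj z0 - cnj z0) * z0" by (simp add: algebra_simps)
      also have "\<dots> = - a * cnj b * z0" by (simp add: ab[symmetric])
      finally have "cnj z0 * b = - a * cnj b * z0" .
      moreover have "- a * cnj b * z + cnj z0 * (a * z) = cnj z0 * z" by (simp add: ab algebra_simps)
      ultimately show ?thesis by (simp add: algebra_simps)
    qed
    hence "exp (- a * cnj b * z) * exp (cnj z0 * (a * z + b)) = exp (- a * cnj b * z0) * exp (cnj z0 * z)"
      by (simp only: exp_add[symmetric])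
    thus ?thesis unfolding u_eq[of z] u_eq[of z0]
      by (simp add: weyl_def exp_diff arg[symmetric] mult_ac)
  qed
  let ?f = "weyl 1 (- z0) one" and ?g = "weyl 1 (- z0) (\<lambda>z. z)"
  have fg: "?f \<in> F" "?g \<in> F"
    using weyl_isometry(1)[OF p] one_mem fock_ident_mem[OF p] by auto
  have nz: "?f z0 \<noteq> 0" "?g (z0 + 1) \<noteq> 0" by (simp_all add: weyl_def)
  have "W ?f z = u z0 * ?f z" for z
    using E[of z one] by (simp add: weighted_comp_def)
  from ritt_eigenvalue[OF \<open>ritt\<close> fg(1) nz(1) this] have 1: "u z0 = 1"
    using norm_factor cmod_u_fixed_point[OF z0] by simp
  have "W ?g z = (a * u z0) * ?g z" for z
    using E[of z "\<lambda>z. z"] by (simp add: weighted_comp_def) (simp add: weyl_def)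
  from ritt_eigenvalue[OF \<open>ritt\<close> fg(2) nz(2) this] have "a * u z0 = 1"
    using norm_factor cmod_u_fixed_point[OF z0] a by (simp add: norm_mult)
  with 1 a1 show False by simp
qed

end

lemma Re_of_nat_times: "Re (of_nat k * z) = real k * Re z"
  by simp

section \<open>Translations\<close>

context
  assumes a: "a = 1"
begin

text \<open>The normalised reproducing kernel at w - k b; each application of W moves the centre by
  -b.\<close>

definition coherent :: "complex \<Rightarrow> nat \<Rightarrow> complex \<Rightarrow> complex" where
  "coherent w k = weyl 1 (of_nat k * b - w) one"

lemma coherent_mem: "coherent w k \<in> F" and norm_coherent: "N (coherent w k) = N one"
  unfolding coherent_def using weyl_isometry[OF p one_mem] by auto

lemma coherent_eq: "coherent w k z = exp (- cnj (of_nat k * b - w) * z - of_real ((cmod (of_nat k * b - w))\<^sup>2 / 2))"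
  by (simp add: coherent_def weyl_def)

lemma cmod_centre_power2:
  assumes "Re (cnj w * b) = 0"
  shows "(cmod (of_nat k * b - w))\<^sup>2 = (real k)\<^sup>2 * (cmod b)\<^sup>2 + (cmod w)\<^sup>2"
proof -
  have "(cmod (x - w))\<^sup>2 = (cmod x)\<^sup>2 + (cmod w)\<^sup>2 - 2 * Re (cnj w * x)" for x
    unfolding cmod_power2 by (simp add: power2_eq_square algebra_simps)
  from this[of "of_nat k * b"]
  have "(cmod (of_nat k * b - w))\<^sup>2 = (real k)\<^sup>2 * (cmod b)\<^sup>2 + (cmod w)\<^sup>2 - 2 * Re (cnj w * (of_nat k * b))"
    by (simp add: norm_mult power_mult_distrib)
  also have "cnj w * (of_nat k * b) = of_nat k * (cnj w * b)" by simp
  also have "Re \<dots> = real k * Re (cnj w * b)" by (rule Re_of_nat_times)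
  finally show ?thesis using assms by simp
qed

text \<open>Choosing w orthogonal to b makes \<open>exp (cnj w * b)\<close> unimodular with a phase
  that can be prescribed.\<close>

lemma W_coherent:
  assumes w: "Re (cnj w * b) = 0"
  shows "W (coherent w k) = (\<lambda>z. norm_factor * exp (cnj w * b) * coherent w (Suc k) z)"
proof
  fix z
  have b2: "complex_of_real ((cmod b)\<^sup>2) = cnj b * b" by (simp only: complex_norm_square mult.commute)
  have n2: "complex_of_real ((cmod (of_nat k * b - w))\<^sup>2) =
      of_nat k * of_nat k * (cnj b * b) + of_real ((cmod w)\<^sup>2)" for k
    unfolding cmod_centre_power2[OF w] b2[symmetric] by (simp add: power2_eq_square)
  have "- cnj b * z + (- cnj (of_nat k * b - w) * (z + b) - of_real ((cmod (of_nat k * b - w))\<^sup>2 / 2)) =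
      of_real ((cmod b)\<^sup>2 / 2) + cnj w * b +
      (- cnj (of_nat (Suc k) * b - w) * z - of_real ((cmod (of_nat (Suc k) * b - w))\<^sup>2 / 2))"
    by (simp only: of_real_divide n2 b2) (simp add: field_simps)
  hence "exp (- cnj b * z) * exp (- cnj (of_nat k * b - w) * (z + b) - of_real ((cmod (of_nat k * b - w))\<^sup>2 / 2)) =
      exp (of_real ((cmod b)\<^sup>2 / 2)) * exp (cnj w * b) *
      exp (- cnj (of_nat (Suc k) * b - w) * z - of_real ((cmod (of_nat (Suc k) * b - w))\<^sup>2 / 2))"
    by (simp only: exp_add[symmetric])
  moreover have "u z = u 0 * exp (- cnj b * z)" using u_eq[of z] a by simp
  moreover have "W (coherent w k) z = u z * coherent w k (z + b)" by (simp add: weighted_comp_def a)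
  ultimately show "W (coherent w k) z = norm_factor * exp (cnj w * b) * coherent w (Suc k) z"
    by (simp only: coherent_eq norm_factor_def exp_of_real[symmetric] mult.assoc)
qed

text \<open>At -(m b) the phase is independent of k, so sums over k do not cancel. At the centre w -
  m b itself it would in general depend on k; the price of the shift is the constant
  \<open>exp (- (cmod w)\<^sup>2 / 2)\<close>.\<close>

lemma coherent_at:
  assumes w: "Re (cnj w * b) = 0"
  shows "coherent w k (- (of_nat m * b)) = exp (- (of_nat m * (cnj w * b))) *
    of_real (exp (real m * real k * (cmod b)\<^sup>2 - ((real k)\<^sup>2 * (cmod b)\<^sup>2 + (cmod w)\<^sup>2) / 2))"
proof -
  have b2: "complex_of_real ((cmod b)\<^sup>2) = cnj b * b" by (simp only: complex_norm_square mult.commute)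
  have "- cnj (of_nat k * b - w) * (- (of_nat m * b)) = of_nat m * of_nat k * (cnj b * b) - of_nat m * (cnj w * b)"
    by (simp add: algebra_simps)
  also have "\<dots> = of_real (real m * real k * (cmod b)\<^sup>2) - of_nat m * (cnj w * b)"
    by (simp only: of_real_mult b2 of_real_of_nat_eq)
  finally have "- cnj (of_nat k * b - w) * (- (of_nat m * b)) - of_real ((cmod (of_nat k * b - w))\<^sup>2 / 2) =
      - (of_nat m * (cnj w * b)) +
      of_real (real m * real k * (cmod b)\<^sup>2 - ((real k)\<^sup>2 * (cmod b)\<^sup>2 + (cmod w)\<^sup>2) / 2)"
    unfolding cmod_centre_power2[OF w] of_real_diff by (simp only: add_uminus_conv_diff[symmetric] ac_simps)
  thus ?thesis by (simp only: coherent_eq exp_add exp_of_real)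
qed

lemma sum_mem: "(\<And>k. g k \<in> F) \<Longrightarrow> (\<lambda>z. \<Sum>k<n. g k z) \<in> F" for n :: nat
  by (induction n) (auto intro: zero_mem add_mem)

lemma pencil_sum: "pencil W \<mu> (\<lambda>z. \<Sum>k<n. g k z) = (\<lambda>z. \<Sum>k<n. pencil W \<mu> (g k) z)" for n :: nat
  by (simp add: pencil_def weighted_comp_def sum_subtractf sum_distrib_left)

text \<open>The operator maps \<open>coherent w k\<close> to \<open>\<mu> * coherent w (k + 1)\<close>. If \<open>\<mu> - W\<close> were bounded below, the sums
  \<open>S j n\<close> and then the triangular double sums \<open>H n\<close> would be bounded in norm; but at the centre of
  the middle term all summands of \<open>H n\<close> have the same argument, so that \<open>H n\<close> grows linearly.\<close>

lemma ritt_translation_eigenvalue: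
  assumes ritt and w: "Re (cnj w * b) = 0" and norm_factor: "cmod norm_factor \<ge> 1"
  shows "norm_factor * exp (cnj w * b) = 1"
proof (rule ccontr)
  define \<mu> where "\<mu> = norm_factor * exp (cnj w * b)"
  assume "\<not> ?thesis"
  hence \<mu>1: "cmod (\<mu> - 1) > 0" by (simp add: \<mu>_def)
  have "cmod \<mu> = cmod norm_factor" using w by (simp only: \<mu>_def norm_mult norm_exp_eq_Re exp_zero mult_1_right)
  hence \<mu>: "cmod \<mu> \<ge> 1" using norm_factor by simp
  obtain M where M: "M > 0"
    "\<And>f. f \<in> F \<Longrightarrow> cmod (\<mu> - 1) * N f \<le> M * N (pencil W \<mu> f)"
    using ritt_condition_lower_bound[OF bounded \<open>ritt\<close>] \<mu> by blast
  define K where "K = M / cmod (\<mu> - 1) * cmod \<mu>"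
  have K: "K \<ge> 0" using M \<mu>1 by (simp add: K_def)
  have bound: "N f \<le> K * (N g + N h)"
    if "f \<in> F" "g \<in> F" "h \<in> F" "\<And>z. pencil W \<mu> f z = \<mu> * (g z - h z)" for f g h
  proof -
    have "pencil W \<mu> f = (\<lambda>z. \<mu> * (g z - h z))" using that(4) by auto
    hence "N (pencil W \<mu> f) = cmod \<mu> * N (\<lambda>z. g z - h z)"
      using norm_scale[OF diff_mem[OF that(2,3)]] by simp
    also have "N (\<lambda>z. g z - h z) \<le> N g + N (\<lambda>z. -1 * h z)"
      by (rule norm_le_add[OF that(2) scale_mem[OF that(3)]]) simp
    also have "N (\<lambda>z. -1 * h z) = N h" using norm_scale[OF that(3), of "-1"] by simp
    finally have "M * N (pencil W \<mu> f) \<le> M * (cmod \<mu> * (N g + N h))"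
      using M(1) by (simp add: mult_left_mono)
    with M(2)[OF that(1)] have "cmod (\<mu> - 1) * N f \<le> M * (cmod \<mu> * (N g + N h))" by linarith
    thus ?thesis using \<mu>1 by (simp add: K_def field_simps)
  qed
  \<comment> \<open>Both sums telescope under the pencil. A single sum would give no contradiction:
    kernels decay away from their centres, so its values in weighted modulus stay bounded. H counts
    the middle kernel repeatedly.\<close>
  define S where "S j n = (\<lambda>z. \<Sum>k<n. coherent w (j + k) z)" for j n
  define H where "H n = (\<lambda>z. \<Sum>j<n. S j n z)" for n
  have mem: "S j n \<in> F" "H n \<in> F" for j n
    unfolding S_def H_def by (intro sum_mem coherent_mem)+
  have pe: "pencil W \<mu> (coherent w k) z = \<mu> * (coherent w k z - coherent w (Suc k) z)" for k z
    by (simp only: pencil_def W_coherent[OF w] \<mu>_def right_diff_distrib)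
  have pS: "pencil W \<mu> (S j n) z = \<mu> * (coherent w j z - coherent w (j + n) z)" for j n z
  proof -
    have "pencil W \<mu> (S j n) z = \<mu> * (\<Sum>k<n. coherent w (j + k) z - coherent w (j + Suc k) z)"
      unfolding S_def pencil_sum by (simp add: pe sum_distrib_left)
    also have "(\<Sum>k<n. coherent w (j + k) z - coherent w (j + Suc k) z) = coherent w j z - coherent w (j + n) z"
      using sum_lessThan_telescope'[of "\<lambda>k. coherent w (j + k) z" n] by simp
    finally show ?thesis .
  qed
  have NS: "N (S j n) \<le> K * (N one + N one)" for j n
    using bound[OF mem(1) coherent_mem coherent_mem pS] by (simp add: norm_coherent)
  have pH: "pencil W \<mu> (H n) z = \<mu> * (S 0 n z - S n n z)" for n z
    unfolding H_def pencil_sum pS by (simp add: S_def sum_subtractf sum_distrib_left algebra_simps)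
  have NH: "N (H n) \<le> K * (2 * (K * (N one + N one)))" for n
  proof -
    have "N (H n) \<le> K * (N (S 0 n) + N (S n n))"
      by (rule bound[OF mem(2) mem(1) mem(1) pH])
    also have "\<dots> \<le> K * (2 * (K * (N one + N one)))"
      using NS[of 0 n] NS[of n n] K by (intro mult_left_mono) auto
    finally show ?thesis .
  qed
  obtain C where C: "C > 0" "\<And>g z. g \<in> F \<Longrightarrow> fock_mod g z \<le> C * N g"
    using fock_mod_le[OF p] by blast
  define r where "r m k = exp (real m * real k * (cmod b)\<^sup>2 - ((real k)\<^sup>2 * (cmod b)\<^sup>2 + (cmod w)\<^sup>2) / 2)" for m k
  have r0: "r m k > 0" for m k by (simp add: r_def)
  have low: "real (Suc m) * exp (- (cmod w)\<^sup>2 / 2) \<le> fock_mod (H (Suc m)) (- (of_nat m * b))" for m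
  proof -
    let ?\<theta> = "exp (- (of_nat m * (cnj w * b)))"
    have th: "cmod ?\<theta> = 1"
    proof -
      have "Re (- (of_nat m * (cnj w * b))) = - (real m * Re (cnj w * b))"
        using Re_of_nat_times[of m "cnj w * b"] by simp
      thus ?thesis using w by (simp only: norm_exp_eq_Re) simp
    qed
    have "H (Suc m) (- (of_nat m * b)) = ?\<theta> * of_real (\<Sum>j<Suc m. \<Sum>k<Suc m. r m (j + k))"
      unfolding H_def S_def coherent_at[OF w] r_def of_real_sum sum_distrib_left ..
    hence "cmod (H (Suc m) (- (of_nat m * b))) = (\<Sum>j<Suc m. \<Sum>k<Suc m. r m (j + k))"
      using r0 by (simp only: norm_mult th norm_of_real) (simp add: sum_nonneg less_imp_le abs_of_nonneg)
    \<comment> \<open>For n = m + 1 every j \<le> m has exactly one partner k = m - j in range, so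
      the middle kernel occurs m + 1 times.\<close>
    moreover have "(\<Sum>j<Suc m. r m m) \<le> (\<Sum>j<Suc m. \<Sum>k<Suc m. r m (j + k))"
    proof (rule sum_mono)
      fix j assume "j \<in> {..<Suc m}"
      hence "r m m = r m (j + (m - j))" by simp
      also have "\<dots> \<le> (\<Sum>k<Suc m. r m (j + k))"
        by (rule member_le_sum[of "m - j" "{..<Suc m}" "\<lambda>k. r m (j + k)"]) (auto simp: r0 less_imp_le)
      finally show "r m m \<le> (\<Sum>k<Suc m. r m (j + k))" .
    qed
    ultimately have "real (Suc m) * r m m \<le> cmod (H (Suc m) (- (of_nat m * b)))" by simp
    hence "real (Suc m) * r m m * exp (- (cmod (of_nat m * b))\<^sup>2 / 2) \<le> fock_mod (H (Suc m)) (- (of_nat m * b))"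
      unfolding fock_mod_def norm_minus_cancel by (intro mult_right_mono) auto
    also have "real (Suc m) * r m m * exp (- (cmod (of_nat m * b))\<^sup>2 / 2) = real (Suc m) * exp (- (cmod w)\<^sup>2 / 2)"
      unfolding r_def mult.assoc exp_add[symmetric]
      by (simp add: norm_mult power_mult_distrib power2_eq_square field_simps)
    finally show ?thesis .
  qed
  define D where "D = C * (K * (2 * (K * (N one + N one))))"
  have "real (Suc m) \<le> D * exp ((cmod w)\<^sup>2 / 2)" for m
  proof -
    have "real (Suc m) * exp (- (cmod w)\<^sup>2 / 2) \<le> C * N (H (Suc m))"
      using low[of m] C(2)[OF mem(2)] by (rule order_trans)
    also have "\<dots> \<le> D" unfolding D_def using C(1) NH by (intro mult_left_mono) auto
    finally have "real (Suc m) * exp (- (cmod w)\<^sup>2 / 2) * exp ((cmod w)\<^sup>2 / 2) \<le> D * exp ((cmod w)\<^sup>2 / 2)"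
      by (intro mult_right_mono) auto
    thus ?thesis by (simp add: mult.assoc exp_add[symmetric])
  qed
  moreover obtain m where "D * exp ((cmod w)\<^sup>2 / 2) < real m" using reals_Archimedean2 by blast
  ultimately show False by (metis less_le_trans lessI not_less of_nat_less_iff order_less_trans)
qed

text \<open>Taking w = 0 forces the factor to be 1; taking w with cnj(w) b = i \<pi> forces it to be
  -1.\<close>

lemma not_ritt_translation:
  assumes b: "b \<noteq> 0" and norm_factor: "cmod norm_factor \<ge> 1"
  shows "\<not> ritt"
proof
  assume ritt
  have c1: "norm_factor = 1" using ritt_translation_eigenvalue[OF \<open>ritt\<close> _ norm_factor, where w = 0] by simp
  define w where "w = cnj (\<i> * pi / b)"
  have "cnj w * b = \<i> * pi" using b by (simp add: w_def)
  hence "norm_factor * exp (\<i> * pi) = 1"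
    using ritt_translation_eigenvalue[OF \<open>ritt\<close> _ norm_factor, where w = w] by simp
  thus False using c1 by simp
qed

text \<open>Kernels whose centres run off along -k b tend to 0 pointwise, while their images under W
  keep the norm |\<open>norm_factor\<close>| after normalisation. A norm limit of the images is also
  a pointwise limit, hence 0.\<close>

lemma compact_translation_zero:
  assumes b: "b \<noteq> 0" and comp: "compact_op_on F N W"
  shows "norm_factor = 0"
proof -
  have N1: "N one > 0" by (rule norm_pos[OF one_mem]) simp
  define f where "f k = (\<lambda>z. of_real (1 / N one) * coherent 0 k z)" for k
  have f: "f k \<in> F" "N (f k) = 1" for k
    using scale_mem[OF coherent_mem, where c = "of_real (1 / N one)"] norm_scale[OF coherent_mem, where c = "of_real (1 / N one)"] N1
    by (simp_all add: f_def norm_coherent norm_divide)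
  obtain l r where l: "l \<in> F" and r: "strict_mono (r::nat\<Rightarrow>nat)"
    and lim: "(\<lambda>n. N (\<lambda>x. W (f (r n)) x - l x)) \<longlonglongrightarrow> 0"
    using compact_op_subseq[OF bounded comp, of f] f by auto
  obtain C where C: "C > 0" "\<And>g z. g \<in> F \<Longrightarrow> fock_mod g z \<le> C * N g"
    using fock_mod_le[OF p] by blast
  have b2: "(cmod b)\<^sup>2 / 2 > 0" using b by simp
  have e0: "(\<lambda>k. fock_mod (coherent 0 k) z) \<longlonglongrightarrow> 0" for z
  proof -
    have "fock_mod (coherent 0 k) z = exp (- (cmod z)\<^sup>2 / 2) * exp (- (real k * Re (cnj b * z)) - (real k)\<^sup>2 * ((cmod b)\<^sup>2 / 2))" for k
      using Re_of_nat_times[of k "cnj b * z"]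
      by (simp add: fock_mod_def coherent_def weyl_def norm_mult power_mult_distrib mult.assoc)
    moreover have "(\<lambda>k. exp (- (cmod z)\<^sup>2 / 2) * exp (- (real k * Re (cnj b * z)) - (real k)\<^sup>2 * ((cmod b)\<^sup>2 / 2))) \<longlonglongrightarrow> 0"
      using b2 by real_asymp
    ultimately show ?thesis by simp
  qed
  have "l z = 0" for z
  proof -
    have W0: "(\<lambda>n. fock_mod (W (f (r n))) z) \<longlonglongrightarrow> 0"
    proof -
      have "fock_mod (W (f k)) z = cmod (u z) * exp (- (cmod z)\<^sup>2 / 2) * exp ((cmod (z + b))\<^sup>2 / 2) / N one * fock_mod (coherent 0 k) (z + b)" for k
        using N1 by (simp add: fock_mod_def weighted_comp_def f_def a norm_mult norm_divide exp_minus)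
      moreover have "(\<lambda>k. cmod (u z) * exp (- (cmod z)\<^sup>2 / 2) * exp ((cmod (z + b))\<^sup>2 / 2) / N one * fock_mod (coherent 0 k) (z + b)) \<longlonglongrightarrow> 0"
        using e0 by (rule tendsto_mult_right_zero)
      ultimately have "(\<lambda>k. fock_mod (W (f k)) z) \<longlonglongrightarrow> 0" by simp
      from LIMSEQ_subseq_LIMSEQ[OF this r] show ?thesis by (simp add: o_def)
    qed
    have "fock_mod l z \<le> fock_mod (W (f (r n))) z + C * N (\<lambda>x. W (f (r n)) x - l x)" for n
    proof -
      have "cmod (l z) \<le> cmod (W (f (r n)) z) + cmod (W (f (r n)) z - l z)"
        using norm_triangle_ineq4[of "W (f (r n)) z" "W (f (r n)) z - l z"] by simp
      hence "fock_mod l z \<le> fock_mod (W (f (r n))) z + fock_mod (\<lambda>x. W (f (r n)) x - l x) z"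
        unfolding fock_mod_def distrib_right[symmetric] by (intro mult_right_mono) auto
      thus ?thesis using C(2)[OF diff_mem[OF op_mem[OF bounded f(1)] l], of "r n" z] by linarith
    qed
    hence "fock_mod l z \<le> 0 + C * 0"
      by (intro LIMSEQ_le_const[OF tendsto_add[OF W0 tendsto_mult[OF tendsto_const lim]]]) auto
    thus ?thesis by (simp add: fock_mod_def mult_le_0_iff)
  qed
  hence "(\<lambda>n. N (W (f (r n)))) \<longlonglongrightarrow> 0" using lim by simp
  moreover have "N (W (f k)) = cmod norm_factor" for k
    using a by (subst norm_W) (simp_all add: f)
  ultimately have "(\<lambda>n. cmod norm_factor) \<longlonglongrightarrow> 0" by (simp only:)
  thus "norm_factor = 0" by (simp add: LIMSEQ_const_iff)
qed

end

end

theorem theorem3p1: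
  fixes p :: real and a b :: complex and u \<psi> :: "complex \<Rightarrow> complex"
  assumes p: "1 \<le> p"
    and u: "u holomorphic_on UNIV"
    and psi: "\<psi> = (\<lambda>z. a * z + b)"
    and a: "cmod a \<le> 1"
    and bounded: "bounded_op_on (fock_space p) (fock_norm p) (weighted_comp u \<psi>)"
  shows
    "(cmod a = 1 \<longrightarrow>
       (ritt_condition_on (fock_space p) (fock_norm p) (weighted_comp u \<psi>) \<longleftrightarrow>
          (a = 1 \<and> b = 0 \<and> cmod (u 0) < 1) \<or>
          (a = 1 \<and> b = 0 \<and> u 0 = 1) \<or>
          (a = 1 \<and> b \<noteq> 0 \<and> cmod (u 0) < exp (- (cmod b)\<^sup>2 / 2)) \<or>
          (a \<noteq> 1 \<and> cmod (u 0) < exp (- (cmod b)\<^sup>2 / 2)))) \<and>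
     (compact_op_on (fock_space p) (fock_norm p) (weighted_comp u \<psi>) \<longrightarrow>
       (ritt_condition_on (fock_space p) (fock_norm p) (weighted_comp u \<psi>) \<longrightarrow>
          cmod (u (b / (1 - a))) \<le> 1) \<and>
       (cmod (u (b / (1 - a))) < 1 \<longrightarrow>
          ritt_condition_on (fock_space p) (fock_norm p) (weighted_comp u \<psi>)))"
proof -
  interpret fock_weighted_comp p u a b
    using p u bounded unfolding psi by unfold_locales
  \<comment> \<open>For a = 1 division by zero gives z0 = 0, which is a fixed point exactly when b =
    0.\<close>
  define z0 where "z0 = b / (1 - a)"
  have z0: "a * z0 + b = z0" if "a \<noteq> 1 \<or> b = 0"
  proof (cases "a = 1")
    case False
    hence "(1 - a) * z0 = b" by (simp add: z0_def)
    thus ?thesis by (metis add.commute diff_add_cancel left_diff_distrib mult_1)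
  qed (use that in \<open>simp add: z0_def\<close>)
  have norm_factor_less: "cmod norm_factor < 1 \<longleftrightarrow> cmod (u 0) < exp (- (cmod b)\<^sup>2 / 2)"
    by (simp add: cmod_norm_factor exp_minus field_simps)
  have ritt_iff: "ritt \<longleftrightarrow> cmod norm_factor < 1 \<or> (a = 1 \<and> b = 0 \<and> u 0 = 1)" if a: "cmod a = 1"
  proof
    assume ritt
    show "cmod norm_factor < 1 \<or> (a = 1 \<and> b = 0 \<and> u 0 = 1)"
    proof (cases "cmod norm_factor < 1")
      case False
      hence norm_factor: "cmod norm_factor \<ge> 1" by simp
      have "a = 1"
      proof (rule ccontr)
        assume "a \<noteq> 1"
        with not_ritt_rotation[OF a z0 _ norm_factor] \<open>ritt\<close> show False by blast
      qed
      have "b = 0"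
        using not_ritt_translation[OF \<open>a = 1\<close> _ norm_factor] \<open>ritt\<close> by blast
      have "W one z = norm_factor * one z" for z
        unfolding norm_factor_def using u_eq[OF a, of z] \<open>b = 0\<close> by (simp add: weighted_comp_def)
      from ritt_eigenvalue[OF \<open>ritt\<close> one_mem _ this] False have "norm_factor = 1" by simp
      hence "u 0 = 1" unfolding norm_factor_def using \<open>b = 0\<close> by simp
      with \<open>a = 1\<close> \<open>b = 0\<close> show ?thesis by simp
    qed simp
  next
    assume "cmod norm_factor < 1 \<or> (a = 1 \<and> b = 0 \<and> u 0 = 1)"
    thus ritt
    proof
      assume "cmod norm_factor < 1"
      thus ritt by (rule ritt_if_contraction[OF a])
    next
      assume *: "a = 1 \<and> b = 0 \<and> u 0 = 1"
      hence "u z = 1" for z using u_eq[OF a, of z] by simp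
      hence "W f = f" for f using * by (simp add: weighted_comp_def)
      thus ritt by (rule ritt_condition_identity[OF bounded[unfolded psi]])
    qed
  qed
  have "cmod (u z0) \<le> 1" if comp: "compact_op_on F N W" and ritt
  proof (cases "a \<noteq> 1 \<or> b = 0")
    case True
    thus ?thesis using ritt_fixed_point[OF \<open>ritt\<close> z0] by simp
  next
    case False
    \<comment> \<open>A proper translation has no fixed point; here z0 = 0, and compactness gives
      u(0) = 0.\<close>
    with compact_translation_zero[OF _ _ comp] have "norm_factor = 0" by blast
    hence "u 0 = 0" by (simp add: norm_factor_def)
    with False show ?thesis by (simp add: z0_def)
  qed
  moreover have ritt if comp: "compact_op_on F N W" and less: "cmod (u z0) < 1"
  proof (cases "cmod a = 1")
    case False
    with a have "cmod a < 1" by simp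
    moreover from this have "a * z0 + b = z0" by (intro z0) auto
    ultimately show ?thesis using less comp by (intro compact_ritt)
  next
    case True
    \<comment> \<open>For |a| = 1 the claim is reduced to the contraction case of part (1), either
      through the fixed point or because W = 0.\<close>
    have "cmod norm_factor < 1"
    proof (cases "a \<noteq> 1 \<or> b = 0")
      case fixed: True
      show ?thesis using cmod_u_fixed_point[OF True z0[OF fixed]] less by simp
    next
      case False
      with compact_translation_zero[OF _ _ comp] have "norm_factor = 0" by blast
      thus ?thesis by simp
    qed
    thus ?thesis using ritt_iff[OF True] by simp
  qed
  moreover have "ritt \<longleftrightarrow>
          (a = 1 \<and> b = 0 \<and> cmod (u 0) < 1) \<or>
          (a = 1 \<and> b = 0 \<and> u 0 = 1) \<or>
          (a = 1 \<and> b \<noteq> 0 \<and> cmod (u 0) < exp (- (cmod b)\<^sup>2 / 2)) \<or>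
          (a \<noteq> 1 \<and> cmod (u 0) < exp (- (cmod b)\<^sup>2 / 2))" if "cmod a = 1"
    unfolding ritt_iff[OF that] norm_factor_less by (cases "a = 1"; cases "b = 0") simp_all
  ultimately show ?thesis
    unfolding psi z0_def[symmetric] by blast
qed

end
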